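(* (i) Let $f:[0,1]\to\mathbb{R}$ be a continuous nowhere differentiable function whose lower and upper Hölder exponents coincide at every point, i.e. $\underline{h}_f(t)=\overline{h}_f(t)$ for all $t\in[0,1]$. Then there exists a sequence $(H_j)_{j\in\mathbb{N}}$ of continuous functions from $[0,1]$ to $[0,1]$ such that \[ \underline{h}_f(t)=\overline{h}_f(t)=\lim_{j\to\infty}H_j(t)\qquad\text{for all } t\in[0,1]. \] (ii) Conversely, let $H:[0,1]\to[0,1]$ be a function such that $H(t)=\lim_{j\to\infty}H_j(t)$ for all $t\in[0,1]$, where $(H_j)_{j\in\mathbb{N}}$ is a sequence of continuous functions on $[0,1]$. Then there exists a continuous function $f:[0,1]\to\mathbb{R}$ such that \[ \underline{h}_f(t)=\overline{h}_f(t)=H(t)\qquad\text{for all } t\in[0,1]. \]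
   Context: Let $f$ be a locally bounded real function on a domain $D$ (here $D=[0,1]$), $x_0\in D$, $\alpha\ge 0$; $[\alpha]$ is the integer part of $\alpha$. Balls $B(x_0,r)$ are understood relative to $D$. Finite differences: $\Delta^1_hf(x)=f(x+h)-f(x)$, $\Delta_h^{n+1}f(x)=\Delta_h^nf(x+h)-\Delta_h^nf(x)$. Put $B_h(x_0,r)=\{x:[x,x+([\alpha]+1)h]\subset B(x_0,r)\}$. $f\in C^\alpha(x_0)$ if there are $C,R>0$ and a polynomial $P$ of degree less than $\alpha$ with $\|f-P\|_{L^\infty(B(x_0,r))}\le Cr^\alpha$ for all $0<r\le R$. $f\in I^\alpha(x_0)$ if there are $C,R>0$ with $\sup_{|h|\le r}\|\Delta_h^{[\alpha]+1}f\|_{L^\infty(B_h(x_0,r))}\ge Cr^\alpha$ for all $0<r\le R$. Lower Hölder exponent: $\underline{h}_f(x_0)=\sup\{\alpha: f\in C^\alpha(x_0)\}$. Upper Hölder exponent: $\overline{h}_f(x_0)=\inf\{\alpha:f\in I^\alpha(x_0)\}$. *)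

theory Defs
  imports "HOL-Probability.Essential_Supremum" "HOL-Computational_Algebra.Polynomial"
begin

text \<open>
  All notions are relative to a domain \<open>D\<close>: a function on \<open>D\<close> is a total function \<open>real \<Rightarrow> real\<close>
  whose values outside \<open>D\<close> are never used.
\<close>

definition rel_ball :: "real set \<Rightarrow> real \<Rightarrow> real \<Rightarrow> real set" where
  "rel_ball D x0 r = ball x0 r \<inter> D"

text \<open>
  Taken in \<^typ>\<open>ennreal\<close>, so that the norm over an empty set is \<open>0\<close> and that of an essentially
  unbounded function is \<open>\<infinity>\<close>.
\<close>

definition Linf_norm :: "real set \<Rightarrow> (real \<Rightarrow> real) \<Rightarrow> ennreal" where
  "Linf_norm S g = esssup (lebesgue_on S) (\<lambda>x. ennreal \<bar>g x\<bar>)"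

primrec fin_diff :: "nat \<Rightarrow> real \<Rightarrow> (real \<Rightarrow> real) \<Rightarrow> real \<Rightarrow> real" where
  "fin_diff 0 h f x = f x"
| "fin_diff (Suc n) h f x = fin_diff n h f (x + h) - fin_diff n h f x"

definition diff_order :: "real \<Rightarrow> nat" where
  "diff_order \<alpha> = nat \<lfloor>\<alpha>\<rfloor> + 1"

text \<open>The step \<open>h\<close> may be negative, hence \<^const>\<open>closed_segment\<close>.\<close>

definition diff_ball :: "real set \<Rightarrow> real \<Rightarrow> real \<Rightarrow> real \<Rightarrow> real \<Rightarrow> real set" where
  "diff_ball D \<alpha> h x0 r = {x. closed_segment x (x + real (diff_order \<alpha>) * h) \<subseteq> rel_ball D x0 r}"

text \<open>
  The zero polynomial has degree \<open>-\<infinity>\<close> by convention here, but \<^term>\<open>degree 0 = 0\<close> in the library;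
  the disjunct \<open>P = 0\<close> matters only for \<open>\<alpha> = 0\<close>.
\<close>

definition holder_at :: "real set \<Rightarrow> (real \<Rightarrow> real) \<Rightarrow> real \<Rightarrow> real \<Rightarrow> bool" where
  "holder_at D f \<alpha> x0 \<longleftrightarrow>
     (\<exists>C>0. \<exists>R>0. \<exists>P :: real poly. (P = 0 \<or> real (degree P) < \<alpha>) \<and>
        (\<forall>r. 0 < r \<and> r \<le> R \<longrightarrow>
           Linf_norm (rel_ball D x0 r) (\<lambda>x. f x - poly P x) \<le> ennreal (C * r powr \<alpha>)))"

definition irregular_at :: "real set \<Rightarrow> (real \<Rightarrow> real) \<Rightarrow> real \<Rightarrow> real \<Rightarrow> bool" where
  "irregular_at D f \<alpha> x0 \<longleftrightarrow>
     (\<exists>C>0. \<exists>R>0. \<forall>r. 0 < r \<and> r \<le> R \<longrightarrow>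
        (SUP h\<in>{h. \<bar>h\<bar> \<le> r}. Linf_norm (diff_ball D \<alpha> h x0 r) (fin_diff (diff_order \<alpha>) h f))
          \<ge> ennreal (C * r powr \<alpha>))"

text \<open>
  The exponents are extended reals: both may be \<open>\<infinity>\<close>, the upper one as the infimum of the empty set.
\<close>

definition lower_holder_exp :: "real set \<Rightarrow> (real \<Rightarrow> real) \<Rightarrow> real \<Rightarrow> ereal" where
  "lower_holder_exp D f x0 = Sup {ereal \<alpha> | \<alpha>. 0 \<le> \<alpha> \<and> holder_at D f \<alpha> x0}"

definition upper_holder_exp :: "real set \<Rightarrow> (real \<Rightarrow> real) \<Rightarrow> real \<Rightarrow> ereal" where
  "upper_holder_exp D f x0 = Inf {ereal \<alpha> | \<alpha>. 0 \<le> \<alpha> \<and> irregular_at D f \<alpha> x0}"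

end

theory Submission
  imports Defs "HOL-Real_Asymp.Real_Asymp"
begin

text \<open>
  For \<open>\<alpha> < 1\<close> both exponents only see the oscillation of \<^term>\<open>f\<close> near the point, and without
  differentiability no exponent exceeds \<open>1\<close>. Hence when the two exponents at \<open>t\<close> agree, their
  value is the limit of \<open>ln (osc f r t) / ln r\<close>, truncated to \<open>{0..1}\<close>, along \<open>r = 2\<^sup>-\<^sup>j\<close>, and
  these functions are continuous in \<open>t\<close>.

  Conversely, take a Faber--Schauder series whose coefficient at the dyadic node \<open>s\<close> of generation
  \<open>j\<close> is about \<open>2 powr (- (j * H\<^sub>m s))\<close>, where \<open>m = m(j)\<close> grows so slowly that
  \<open>H\<^sub>m s\<close> is close to \<open>H t\<close> whenever \<open>\<bar>s - t\<bar> \<le> 2 / 2 ^ J\<close> and \<open>J \<le> j \<le> J\<^sup>2\<close>. Capping the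
  coefficients by \<open>2 powr (- sqrt j)\<close> makes the generations beyond \<open>J\<^sup>2\<close> contribute only \<open>O(2\<^sup>-\<^sup>J)\<close>,
  without affecting the exponents, even where \<open>H t = 0\<close>. The second difference over a dyadic
  interval is minus a single coefficient, which gives irregularity at every scale, and does so of
  order two, as is needed where \<open>H t = 1\<close>.
\<close>

section \<open>Essential suprema of continuous functions\<close>

lemma Linf_norm_le:
  assumes "continuous_on S g" "S \<in> sets lebesgue" "\<And>x. x \<in> S \<Longrightarrow> \<bar>g x\<bar> \<le> C"
  shows "Linf_norm S g \<le> ennreal C"
  unfolding Linf_norm_def
proof (rule esssup_I)
  have "g \<in> borel_measurable (lebesgue_on S)"
    using assms(1,2) by (rule continuous_imp_measurable_on_sets_lebesgue)
  then show "(\<lambda>x. ennreal \<bar>g x\<bar>) \<in> borel_measurable (lebesgue_on S)"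
    by measurable
  show "AE x in lebesgue_on S. ennreal \<bar>g x\<bar> \<le> ennreal C"
    using assms(3) by (intro AE_I2 ennreal_leI) (simp add: space_restrict_space)
qed

text \<open>If \<open>\<bar>g x\<bar>\<close> exceeded the norm, so would
  \<open>\<bar>g\<bar>\<close> on a relative neighbourhood of \<open>x\<close>. Convexity with
  nonempty interior puts \<open>x\<close> in the closure of the interior, so this neighbourhood
  contains a nonempty open set, which cannot be null.\<close>

lemma abs_le_Linf_norm:
  assumes S: "convex S" "interior S \<noteq> {}" "S \<in> sets lebesgue" and g: "continuous_on S g" and x: "x \<in> S"
  shows "ennreal \<bar>g x\<bar> \<le> Linf_norm S g"
proof (rule ccontr)
  define e where "e = Linf_norm S g"
  assume "\<not> ?thesis"
  then have less: "e < ennreal \<bar>g x\<bar>" by (simp add: e_def)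
  then obtain c where c: "e = ennreal c" "0 \<le> c" by (cases e) auto
  have "openin (top_of_set S) (S \<inter> (\<lambda>y. \<bar>g y\<bar>) -` {c<..})"
    using g by (intro continuous_openin_preimage_gen continuous_intros) auto
  then obtain T where T: "open T" "S \<inter> (\<lambda>y. \<bar>g y\<bar>) -` {c<..} = S \<inter> T"
    by (auto simp: openin_open)
  have "x \<in> T" using T(2) x less c by (auto simp: ennreal_less_iff)
  moreover have "x \<in> closure (interior S)"
    using convex_closure_interior[OF S(1,2)] x closure_subset by auto
  ultimately have ne: "T \<inter> interior S \<noteq> {}"
    using T(1) by (meson closure_iff_nhds_not_empty inf_commute order_refl open_Int_closure_eq_empty disjoint_iff)
  have "AE y in lebesgue_on S. ennreal \<bar>g y\<bar> \<le> e"
    unfolding e_def Linf_norm_def by (rule esssup_AE)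
  then have "AE y in lebesgue. y \<in> S \<longrightarrow> ennreal \<bar>g y\<bar> \<le> e"
    using S(3) by (simp add: AE_restrict_space_iff)
  then obtain N where N: "{y. \<not> (y \<in> S \<longrightarrow> ennreal \<bar>g y\<bar> \<le> e)} \<subseteq> N" "N \<in> null_sets lebesgue"
    by (auto simp: eventually_ae_filter)
  have "y \<in> S \<and> \<not> ennreal \<bar>g y\<bar> \<le> e" if "y \<in> T \<inter> interior S" for y
  proof -
    have "y \<in> S" using that interior_subset by auto
    then have "c < \<bar>g y\<bar>" using T(2) that by auto
    then show ?thesis using \<open>y \<in> S\<close> c by (simp add: ennreal_less_iff not_le)
  qed
  then have "T \<inter> interior S \<subseteq> N" using N(1) by blast
  then have "negligible (T \<inter> interior S)"
    using N(2) negligible_iff_null_sets negligible_subset by blast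
  then show False
    using open_not_negligible[OF _ ne] T(1) by auto
qed

section \<open>The exponents in pointwise terms\<close>

lemma convex_rel_ball: "convex D \<Longrightarrow> convex (rel_ball D x r)"
  by (simp add: rel_ball_def convex_Int)

lemma bounded_rel_ball: "bounded (rel_ball D x r)"
  by (simp add: rel_ball_def bounded_Int)

lemma rel_ball_lebesgue: "convex D \<Longrightarrow> rel_ball D x r \<in> sets lebesgue"
  using convex_rel_ball bounded_rel_ball measurable_convex fmeasurableD by blast

lemma rel_ball_subset: "rel_ball D x r \<subseteq> D"
  by (simp add: rel_ball_def)

lemma mem_rel_ball: "y \<in> rel_ball D x r \<longleftrightarrow> y \<in> D \<and> \<bar>y - x\<bar> < r"
  by (auto simp: rel_ball_def dist_real_def)

text \<open>A segment lies in a convex set as soon as its end points do. Written as a ball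
  intersected with a translate of itself, the domain inherits convexity and boundedness, hence
  measurability.\<close>

lemma diff_ball_convex_eq:
  assumes "convex D"
  shows "diff_ball D \<alpha> h x0 r =
    rel_ball D x0 r \<inter> (+) (- (real (diff_order \<alpha>) * h)) ` rel_ball D x0 r"
proof -
  have "closed_segment a b \<subseteq> rel_ball D x0 r \<longleftrightarrow> a \<in> rel_ball D x0 r \<and> b \<in> rel_ball D x0 r" for a b
    using convex_rel_ball[OF assms] by (meson closed_segment_subset ends_in_segment subsetD)
  then show ?thesis
    by (auto simp: diff_ball_def image_iff) (metis add.commute add_diff_cancel_right' diff_conv_add_uminus)
qed

lemma convex_diff_ball: "convex D \<Longrightarrow> convex (diff_ball D \<alpha> h x0 r)"
  by (simp add: diff_ball_convex_eq convex_Int convex_rel_ball)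

lemma diff_ball_lebesgue:
  assumes "convex D" shows "diff_ball D \<alpha> h x0 r \<in> sets lebesgue"
proof -
  have "bounded (diff_ball D \<alpha> h x0 r)"
    by (simp add: assms diff_ball_convex_eq bounded_Int bounded_rel_ball)
  then show ?thesis
    using convex_diff_ball[OF assms] measurable_convex fmeasurableD by blast
qed

lemma continuous_on_fin_diff:
  assumes "continuous_on D f" "\<And>x i. x \<in> S \<Longrightarrow> i \<le> n \<Longrightarrow> x + real i * h \<in> D"
  shows "continuous_on S (fin_diff n h f)"
  using assms(2)
\<comment> \<open>\<open>S\<close> has to vary: the recursion also evaluates the lower-order
  difference on the translate of \<open>S\<close> by \<open>h\<close>.\<close>
proof (induction n arbitrary: S)
  case 0
  have "S \<subseteq> D" using 0[of _ 0] by auto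
  then show ?case using assms(1) continuous_on_subset[of D f S] by (simp add: eta_contract_eq)
next
  case (Suc n)
  have 1: "continuous_on S (fin_diff n h f)"
    using Suc by auto
  have "continuous_on ((\<lambda>x. x + h) ` S) (fin_diff n h f)"
  proof (rule Suc.IH)
    fix x i assume "x \<in> (\<lambda>x. x + h) ` S" "i \<le> n"
    then obtain y where "x = y + h" "y \<in> S" by auto
    then show "x + real i * h \<in> D"
      using Suc.prems[of y "Suc i"] \<open>i \<le> n\<close> by (simp add: algebra_simps)
  qed
  then have "continuous_on S (\<lambda>x. fin_diff n h f (x + h))"
    by (rule continuous_on_compose2) (auto intro!: continuous_intros)
  then show ?case using 1 by (simp add: continuous_on_diff)
qed

lemma continuous_on_fin_diff_diff_ball:
  assumes "convex D" "continuous_on D f"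
  shows "continuous_on (diff_ball D \<alpha> h x0 r) (fin_diff (diff_order \<alpha>) h f)"
proof (rule continuous_on_fin_diff[OF assms(2)])
  fix x i assume x: "x \<in> diff_ball D \<alpha> h x0 r" and i: "i \<le> diff_order \<alpha>"
  have "diff_order \<alpha> > 0" by (simp add: diff_order_def)
  then have "x + real i * h \<in> closed_segment x (x + real (diff_order \<alpha>) * h)"
    using i unfolding in_segment
    by (intro exI[of _ "real i / real (diff_order \<alpha>)"]) (auto simp: field_simps)
  then show "x + real i * h \<in> D"
    using x by (auto simp: diff_ball_def rel_ball_def)
qed

lemma fin_diff_two: "fin_diff 2 h f x = f (x + 2 * h) - 2 * f (x + h) + f x"
  by (simp add: numeral_2_eq_2 algebra_simps)

lemma diff_order_eq_one: "0 \<le> \<alpha> \<Longrightarrow> \<alpha> < 1 \<Longrightarrow> diff_order \<alpha> = 1"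
  by (simp add: diff_order_def floor_eq_iff)

lemma diff_order_eq_two: "1 \<le> \<alpha> \<Longrightarrow> \<alpha> < 2 \<Longrightarrow> diff_order \<alpha> = 2"
proof -
  assume "1 \<le> \<alpha>" "\<alpha> < 2"
  then have "\<lfloor>\<alpha>\<rfloor> = 1" by (simp add: floor_eq_iff)
  then show ?thesis by (simp add: diff_order_def)
qed

section \<open>Essential-supremum conditions versus pointwise bounds\<close>

text \<open>The constant polynomial \<open>[:f t:]\<close> serves as approximant; its degree 0 is
  admissible because \<alpha> is positive.\<close>

lemma holder_atI:
  assumes f: "continuous_on {0..1} f" and t: "t \<in> {0..1}" and "\<alpha> > 0" "C > 0" "R > 0"
    and le: "\<And>x. x \<in> {0..1} \<Longrightarrow> \<bar>x - t\<bar> < R \<Longrightarrow> \<bar>f x - f t\<bar> \<le> C * \<bar>x - t\<bar> powr \<alpha>"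
  shows "holder_at {0..1} f \<alpha> t"
  unfolding holder_at_def
proof (intro exI conjI allI impI)
  show "C > 0" "R > 0" by fact+
  show "[:f t:] = 0 \<or> real (degree [:f t:]) < \<alpha>" using \<open>\<alpha> > 0\<close> by simp
  fix r assume r: "0 < r \<and> r \<le> R"
  show "Linf_norm (rel_ball {0..1} t r) (\<lambda>x. f x - poly [:f t:] x) \<le> ennreal (C * r powr \<alpha>)"
  proof (rule Linf_norm_le)
    show "continuous_on (rel_ball {0..1} t r) (\<lambda>x. f x - poly [:f t:] x)"
      using continuous_on_subset[OF f rel_ball_subset] by (intro continuous_intros) auto
    show "rel_ball {0..1} t r \<in> sets lebesgue" by (simp add: rel_ball_lebesgue)
    fix x assume x: "x \<in> rel_ball {0..1} t r"
    then have "\<bar>f x - f t\<bar> \<le> C * \<bar>x - t\<bar> powr \<alpha>"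
      using r by (intro le) (auto simp: mem_rel_ball)
    also have "\<dots> \<le> C * r powr \<alpha>"
      using x \<open>C > 0\<close> \<open>\<alpha> > 0\<close> by (intro mult_left_mono powr_mono2) (auto simp: mem_rel_ball)
    finally show "\<bar>f x - poly [:f t:] x\<bar> \<le> C * r powr \<alpha>" by simp
  qed
qed

lemma interior_interval_nonempty:
  fixes a b :: real
  assumes "convex S" "a \<in> S" "b \<in> S" "a < b"
  shows "interior S \<noteq> {}"
proof -
  have "{a<..<b} \<subseteq> S"
    using assms closed_segment_subset[of a S b] by (auto simp: closed_segment_eq_real_ivl)
  then have "{a<..<b} \<subseteq> interior S" by (simp add: interior_maximal)
  then show ?thesis using assms(4) by force
qed

lemma interior_rel_ball_nonempty:
  assumes "t \<in> {0..1}" "r > 0"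
  shows "interior (rel_ball {0..1} t r) \<noteq> {}"
proof -
  \<comment> \<open>Small enough that a step of length \<open>s\<close> from \<open>t\<close>
    towards the middle stays inside both \<open>{0..1}\<close> and the ball.\<close>
  define s where "s = min r 1 / 2"
  have s: "0 < s" "s < r" "s \<le> 1/2" using assms(2) by (auto simp: s_def)
  then obtain u where "u \<in> rel_ball {0..1} t r" "u \<noteq> t"
    using assms that[of "if t \<le> 1/2 then t + s else t - s"]
    by (cases "t \<le> 1/2") (auto simp: mem_rel_ball)
  moreover have "t \<in> rel_ball {0..1} t r" using assms by (simp add: mem_rel_ball)
  ultimately show ?thesis
    using interior_interval_nonempty[of "rel_ball {0..1} t r" t u]
      interior_interval_nonempty[of "rel_ball {0..1} t r" u t]
    by (auto simp: convex_rel_ball neq_iff)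
qed

text \<open>The two factors \<^term>\<open>[:-t, 1:]\<close> split off below leave the first-order Taylor polynomial.\<close>

lemma poly_minus_affine_bound:
  fixes P :: "real poly"
  obtains a b K where "K > 0" "degree P = 0 \<longrightarrow> b = 0"
    "\<And>x. \<bar>x - t\<bar> \<le> 1 \<Longrightarrow> \<bar>poly P x - (a + b * (x - t))\<bar> \<le> K * (x - t)\<^sup>2"
proof -
  define Q where "Q = synthetic_div P t"
  define Q2 where "Q2 = synthetic_div Q t"
  have P: "poly P x = (x - t) * poly Q x + poly P t" for x
    using arg_cong[OF synthetic_div_correct'[of t P], of "\<lambda>p. poly p x"] by (simp add: Q_def algebra_simps)
  have Q: "poly Q x = (x - t) * poly Q2 x + poly Q t" for x
    using arg_cong[OF synthetic_div_correct'[of t Q], of "\<lambda>p. poly p x"] by (simp add: Q2_def algebra_simps)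
  have "compact (poly Q2 ` cball t 1)"
    by (intro compact_continuous_image continuous_intros) auto
  then obtain K where K: "K > 0" "\<And>x. x \<in> cball t 1 \<Longrightarrow> \<bar>poly Q2 x\<bar> \<le> K"
    using compact_imp_bounded bounded_pos[of "poly Q2 ` cball t 1"] by auto
  show ?thesis
  proof (rule that[of K "poly Q t" "poly P t"])
    show "degree P = 0 \<longrightarrow> poly Q t = 0"
      by (metis Q_def degree_pCons_0 degree_0_id synthetic_div_eq_0_iff poly_0)
    fix x assume "\<bar>x - t\<bar> \<le> 1"
    then have "\<bar>poly Q2 x\<bar> \<le> K" using K(2) by (simp add: dist_real_def abs_minus_commute)
    moreover have "poly P x - (poly P t + poly Q t * (x - t)) = poly Q2 x * (x - t)\<^sup>2"
      unfolding P[of x] Q[of x] by (simp add: algebra_simps power2_eq_square)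
    ultimately show "\<bar>poly P x - (poly P t + poly Q t * (x - t))\<bar> \<le> K * (x - t)\<^sup>2"
      by (simp add: abs_mult mult_right_mono)
  qed (use K in auto)
qed

text \<open>The approximating polynomial is replaced by its first-order Taylor polynomial at
  \<open>t\<close>, at the cost of a quadratic error; this caps the exponent at 2. Affine functions
  are exactly what second differences annihilate. For \<alpha> at most 1 the degree bound leaves
  only constants, hence \<open>b = 0\<close>. The restriction \<open>R \<le> 1\<close> makes the
  smaller power the dominant one.\<close>

lemma holder_at_affine:
  assumes f: "continuous_on {0..1} f" and t: "t \<in> {0..1}" and "\<alpha> \<ge> 0"
    and hol: "holder_at {0..1} f \<alpha> t"
  obtains C R a b where "C > 0" "R > 0" "R \<le> 1" "\<alpha> \<le> 1 \<longrightarrow> b = 0"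
    "\<And>r x. 0 < r \<Longrightarrow> r \<le> R \<Longrightarrow> x \<in> {0..1} \<Longrightarrow> \<bar>x - t\<bar> < r \<Longrightarrow>
       \<bar>f x - (a + b * (x - t))\<bar> \<le> C * r powr (min \<alpha> 2)"
proof -
  obtain C R P where CR: "C > 0" "R > 0" and deg: "P = 0 \<or> real (degree P) < \<alpha>"
    and le: "\<And>r. 0 < r \<Longrightarrow> r \<le> R \<Longrightarrow>
      Linf_norm (rel_ball {0..1} t r) (\<lambda>x. f x - poly P x) \<le> ennreal (C * r powr \<alpha>)"
    using hol unfolding holder_at_def by blast
  obtain a b K where K: "K > 0" "degree P = 0 \<longrightarrow> b = 0"
    "\<And>x. \<bar>x - t\<bar> \<le> 1 \<Longrightarrow> \<bar>poly P x - (a + b * (x - t))\<bar> \<le> K * (x - t)\<^sup>2"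
    using poly_minus_affine_bound[of P t] by metis
  show ?thesis
  proof (rule that[of "C + K" "min R 1" b a])
    show "\<alpha> \<le> 1 \<longrightarrow> b = 0" using K(2) deg by auto
    fix r x assume r: "0 < r" "r \<le> min R 1" and x: "x \<in> {0..1}" "\<bar>x - t\<bar> < r"
    have "ennreal \<bar>f x - poly P x\<bar> \<le> Linf_norm (rel_ball {0..1} t r) (\<lambda>x. f x - poly P x)"
      using x t r continuous_on_subset[OF f rel_ball_subset]
      by (intro abs_le_Linf_norm[of _ "\<lambda>x. f x - poly P x"] convex_rel_ball interior_rel_ball_nonempty
          rel_ball_lebesgue continuous_intros) (auto simp: mem_rel_ball)
    also have "\<dots> \<le> ennreal (C * r powr \<alpha>)" using le r by simp
    finally have "\<bar>f x - poly P x\<bar> \<le> C * r powr \<alpha>" using CR by (simp add: ennreal_le_iff)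
    also have "\<dots> \<le> C * r powr (min \<alpha> 2)"
      using CR r by (intro mult_left_mono powr_mono') auto
    finally have 1: "\<bar>f x - poly P x\<bar> \<le> C * r powr (min \<alpha> 2)" .
    have "\<bar>poly P x - (a + b * (x - t))\<bar> \<le> K * \<bar>x - t\<bar>\<^sup>2" using K(3)[of x] x r by simp
    also have "\<dots> \<le> K * r\<^sup>2" using x r K(1) by (intro mult_left_mono power_mono) auto
    also have "r\<^sup>2 = r powr 2" using r by (simp add: powr_numeral)
    also have "K * r powr 2 \<le> K * r powr (min \<alpha> 2)"
      using K(1) r by (intro mult_left_mono powr_mono') auto
    finally have "\<bar>f x - (a + b * (x - t))\<bar> \<le> C * r powr (min \<alpha> 2) + K * r powr (min \<alpha> 2)"
      using 1 by linarith
    then show "\<bar>f x - (a + b * (x - t))\<bar> \<le> (C + K) * r powr (min \<alpha> 2)"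
      by (simp add: algebra_simps)
  qed (use CR K in auto)
qed

text \<open>Here the approximant is a constant; the bound at \<open>x = t\<close> compares it with
  \<open>f t\<close>, and the triangle inequality doubles \<open>C\<close>.\<close>

lemma holder_at_le_one:
  assumes f: "continuous_on {0..1} f" and t: "t \<in> {0..1}" and "0 < \<alpha>" "\<alpha> \<le> 1"
    and hol: "holder_at {0..1} f \<alpha> t"
  obtains C R where "C > 0" "R > 0" "R \<le> 1"
    "\<And>r x. 0 < r \<Longrightarrow> r \<le> R \<Longrightarrow> x \<in> {0..1} \<Longrightarrow> \<bar>x - t\<bar> < r \<Longrightarrow> \<bar>f x - f t\<bar> \<le> C * r powr \<alpha>"
proof -
  obtain C R a b where CR: "C > 0" "R > 0" "R \<le> 1" and "b = 0"
    and le: "\<And>r x. 0 < r \<Longrightarrow> r \<le> R \<Longrightarrow> x \<in> {0..1} \<Longrightarrow> \<bar>x - t\<bar> < r \<Longrightarrow>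
       \<bar>f x - (a + b * (x - t))\<bar> \<le> C * r powr (min \<alpha> 2)"
    using holder_at_affine[OF f t _ hol] assms(3,4) by (metis order_less_imp_le)
  show ?thesis
  proof (rule that[of "2 * C" R])
    fix r x assume r: "0 < r" "r \<le> R" and x: "x \<in> {0..1}" "\<bar>x - t\<bar> < r"
    have "min \<alpha> 2 = \<alpha>" using assms by simp
    then show "\<bar>f x - f t\<bar> \<le> 2 * C * r powr \<alpha>"
      using le[OF r x] le[OF r t] r \<open>b = 0\<close> by auto
  qed (use CR in auto)
qed

text \<open>Below 1 only first differences occur. If all deviations from \<open>f t\<close> in the
  ball were less than a quarter of the prescribed size, every first difference would be at most half
  of it.\<close>

lemma irregular_at_osc:
  assumes f: "continuous_on {0..1} f" and t: "t \<in> {0..1}" and \<alpha>: "0 \<le> \<alpha>" "\<alpha> < 1"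
    and irr: "irregular_at {0..1} f \<alpha> t"
  obtains C R where "C > 0" "R > 0"
    "\<And>r. 0 < r \<Longrightarrow> r \<le> R \<Longrightarrow> \<exists>x\<in>{0..1}. \<bar>x - t\<bar> < r \<and> \<bar>f x - f t\<bar> \<ge> C * r powr \<alpha>"
proof -
  obtain C R where CR: "C > 0" "R > 0" and
    ge: "\<And>r. 0 < r \<Longrightarrow> r \<le> R \<Longrightarrow> ennreal (C * r powr \<alpha>) \<le>
      (SUP h\<in>{h. \<bar>h\<bar> \<le> r}. Linf_norm (diff_ball {0..1} \<alpha> h t r) (fin_diff (diff_order \<alpha>) h f))"
    using irr unfolding irregular_at_def by blast
  show ?thesis
  proof (rule that[of "C / 4" R])
    fix r assume r: "0 < r" "r \<le> R"
    show "\<exists>x\<in>{0..1}. \<bar>x - t\<bar> < r \<and> \<bar>f x - f t\<bar> \<ge> C / 4 * r powr \<alpha>"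
    proof (rule ccontr)
      assume "\<not> ?thesis"
      then have less: "\<bar>f x - f t\<bar> < C / 4 * r powr \<alpha>" if "x \<in> rel_ball {0..1} t r" for x
        using that by (auto simp: mem_rel_ball not_le)
      have "Linf_norm (diff_ball {0..1} \<alpha> h t r) (fin_diff (diff_order \<alpha>) h f)
          \<le> ennreal (C / 2 * r powr \<alpha>)" for h
      proof (rule Linf_norm_le)
        fix x assume "x \<in> diff_ball {0..1} \<alpha> h t r"
        then have "x \<in> rel_ball {0..1} t r" "x + h \<in> rel_ball {0..1} t r"
          unfolding diff_ball_def using \<alpha> by (auto simp: diff_order_eq_one)
        then have "\<bar>f (x + h) - f x\<bar> \<le> C / 2 * r powr \<alpha>"
          using less[of x] less[of "x + h"] by (simp add: abs_real_def split: if_splits)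
        then show "\<bar>fin_diff (diff_order \<alpha>) h f x\<bar> \<le> C / 2 * r powr \<alpha>"
          using \<alpha> by (simp add: diff_order_eq_one)
      qed (use f in \<open>auto intro: diff_ball_lebesgue continuous_on_fin_diff_diff_ball\<close>)
      then have "(SUP h\<in>{h. \<bar>h\<bar> \<le> r}. Linf_norm (diff_ball {0..1} \<alpha> h t r) (fin_diff (diff_order \<alpha>) h f))
          \<le> ennreal (C / 2 * r powr \<alpha>)"
        by (intro SUP_least)
      then have "ennreal (C * r powr \<alpha>) \<le> ennreal (C / 2 * r powr \<alpha>)"
        using ge[OF r] order_trans by blast
      then show False using CR r by (simp add: ennreal_le_iff)
    qed
  qed (use CR in auto)
qed

text \<open>A second difference is a difference of two adjacent first differences, one of which is
  at least half as large. So one hypothesis on second differences serves both possible orders, 1 and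
  2. To be seen by the essential supremum, a single large value needs a domain with nonempty
  interior.\<close>

lemma irregular_atI:
  assumes f: "continuous_on {0..1} f" and t: "t \<in> {0..1}" and \<alpha>: "0 \<le> \<alpha>" "\<alpha> < 2"
    and CR: "C > 0" "R > 0" "R \<le> 1"
    and ex: "\<And>r. 0 < r \<Longrightarrow> r \<le> R \<Longrightarrow> \<exists>x h. 0 < h \<and> 2 * h < r \<and> x \<in> rel_ball {0..1} t r \<and>
      x + 2 * h \<in> rel_ball {0..1} t r \<and> C * r powr \<alpha> \<le> \<bar>f (x + 2 * h) - 2 * f (x + h) + f x\<bar>"
  shows "irregular_at {0..1} f \<alpha> t"
  unfolding irregular_at_def
proof (intro exI conjI allI impI)
  show "C / 2 > 0" "R > 0" using CR by auto
  fix r assume "0 < r \<and> r \<le> R"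
  then have r: "0 < r" "r \<le> R" by auto
  define J where "J = rel_ball {0..1} t r"
  obtain x h where h: "0 < h" "2 * h < r" and x: "x \<in> J" "x + 2 * h \<in> J"
    and ge: "C * r powr \<alpha> \<le> \<bar>f (x + 2 * h) - 2 * f (x + h) + f x\<bar>"
    using ex[OF r] by (auto simp: J_def)
  have convJ: "convex J" by (simp add: J_def convex_rel_ball)
  have "x + h \<in> closed_segment x (x + 2 * h)" using h by (auto simp: closed_segment_eq_real_ivl)
  then have xh: "x + h \<in> J" using closed_segment_subset[OF x convJ] by blast
  define n where "n = diff_order \<alpha>"
  have n: "n = 1 \<or> n = 2" "n \<noteq> 0"
    using \<alpha> diff_order_eq_one[of \<alpha>] diff_order_eq_two[of \<alpha>] unfolding n_def by linarith+
  have "\<exists>y. y \<in> J \<and> y + n * h \<in> J \<and> C / 2 * r powr \<alpha> \<le> \<bar>fin_diff n h f y\<bar>"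
  proof (cases "n = 1")
    case True
    have "C / 2 * r powr \<alpha> \<le> \<bar>f (x + 2 * h) - f (x + h)\<bar> \<or> C / 2 * r powr \<alpha> \<le> \<bar>f (x + h) - f x\<bar>"
      using ge by linarith
    then show ?thesis
    proof
      assume "C / 2 * r powr \<alpha> \<le> \<bar>f (x + 2 * h) - f (x + h)\<bar>"
      then show ?thesis using x xh True
        by (intro exI[of _ "x + h"]) (simp add: algebra_simps)
    next
      assume "C / 2 * r powr \<alpha> \<le> \<bar>f (x + h) - f x\<bar>"
      then show ?thesis using x xh True by (intro exI[of _ x]) simp
    qed
  next
    case False
    then have "n = 2" using n by simp
    moreover have "C / 2 * r powr \<alpha> \<le> C * r powr \<alpha>" using CR by simp
    ultimately show ?thesis
      using x ge by (intro exI[of _ x]) (auto simp: fin_diff_two simp del: fin_diff.simps)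
  qed
  then obtain y where y: "y \<in> J" "y + n * h \<in> J" and yge: "C / 2 * r powr \<alpha> \<le> \<bar>fin_diff n h f y\<bar>"
    by blast
  have DB: "z \<in> diff_ball {0..1} \<alpha> h t r" if "z \<in> J" "z + n * h \<in> J" for z
    using closed_segment_subset[OF that convJ] by (simp add: diff_ball_def n_def J_def)
  have nh: "0 < n * h" "n * h < r" using n h by auto
  \<comment> \<open>As the steps are shorter than the interval \<^term>\<open>J\<close>, the set \<open>diff_ball\<close> is more than a point.\<close>
  obtain a b where ab: "a \<in> J" "b \<in> J" "n * h < b - a"
  proof -
    obtain s where s: "n * h < s" "s < r" using dense[OF nh(2)] by blast
    show ?thesis
    \<comment> \<open>\<open>J\<close> contains \<open>[t, t + s]\<close> or
      \<open>[t - s, t]\<close>, or else all of \<open>{0..1}\<close>. In the last case the length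
      suffices because \<open>n * h < r\<close> and \<open>r \<le> R \<le> 1\<close>.\<close>
    proof (cases "t + s \<le> 1")
      case True
      then show ?thesis using that[of t "t + s"] s t r nh by (auto simp: J_def mem_rel_ball)
    next
      case False
      show ?thesis
      proof (cases "t - s \<ge> 0")
        case True
        then show ?thesis using that[of "t - s" t] s t r nh by (auto simp: J_def mem_rel_ball)
      next
        case F: False
        have "n * h < 1" using nh r CR by simp
        then show ?thesis using that[of 0 1] s t r nh F False by (auto simp: J_def mem_rel_ball)
      qed
    qed
  qed
  have int: "interior (diff_ball {0..1} \<alpha> h t r) \<noteq> {}"
  proof -
    \<comment> \<open>The points \<open>a\<close> and \<open>b - n * h\<close> are distinct members,
      so at least one of them differs from \<open>y\<close>.\<close>
    have ne: "\<exists>z\<in>diff_ball {0..1} \<alpha> h t r. z \<noteq> y"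
    proof -
      have "a + n * h \<in> closed_segment a b" "b - n * h \<in> closed_segment a b"
        using ab nh by (auto simp: closed_segment_eq_real_ivl)
      then have "a + n * h \<in> J" "b - n * h \<in> J"
        using closed_segment_subset[OF ab(1,2) convJ] by blast+
      then have "a \<in> diff_ball {0..1} \<alpha> h t r" "b - n * h \<in> diff_ball {0..1} \<alpha> h t r"
        using ab by (auto intro: DB)
      moreover have "a \<noteq> b - n * h" using ab by simp
      ultimately show ?thesis by metis
    qed
    then show ?thesis
      using DB[OF y] interior_interval_nonempty[OF convex_diff_ball[OF convex_real_interval(5)]]
      by (metis linorder_neqE_linordered_idom)
  qed
  have "ennreal (C / 2 * r powr \<alpha>) \<le> ennreal \<bar>fin_diff n h f y\<bar>"
    using yge by (rule ennreal_leI)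
  also have "\<dots> \<le> Linf_norm (diff_ball {0..1} \<alpha> h t r) (fin_diff n h f)"
    using int f DB[OF y] unfolding n_def
    by (intro abs_le_Linf_norm convex_diff_ball diff_ball_lebesgue continuous_on_fin_diff_diff_ball) auto
  also have "\<dots> \<le> (SUP h\<in>{h. \<bar>h\<bar> \<le> r}. Linf_norm (diff_ball {0..1} \<alpha> h t r) (fin_diff (diff_order \<alpha>) h f))"
    using h unfolding n_def by (intro SUP_upper) auto
  finally show "ennreal (C / 2 * r powr \<alpha>) \<le> \<dots>" .
qed

section \<open>Computing both exponents from pointwise bounds\<close>

lemma powr_eventually_less:
  fixes \<beta> \<gamma> C c R :: real
  assumes "\<beta> < \<gamma>" "C > 0" "c > 0" "R > 0"
  obtains r where "0 < r" "r \<le> R" "C * r powr \<gamma> < c * r powr \<beta>"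
proof -
  define d where "d = \<gamma> - \<beta>"
  \<comment> \<open>With \<open>r powr d \<le> s\<close> the left side is at most half of the right
    one.\<close>
  define s where "s = c / (2 * C)"
  define r where "r = min R (s powr (1 / d))"
  have d: "d > 0" and s: "s > 0" using assms by (auto simp: d_def s_def)
  then have r: "r > 0" using assms by (auto simp: r_def)
  have "r powr d \<le> (s powr (1 / d)) powr d" using r d by (intro powr_mono2) (auto simp: r_def)
  also have "\<dots> = s" using d s by (simp add: powr_powr)
  finally have "C * r powr d \<le> C * s" using assms by simp
  also have "\<dots> < c" using assms by (simp add: s_def)
  finally have "C * r powr d * r powr \<beta> < c * r powr \<beta>" using r by simp
  moreover have "r powr \<gamma> = r powr d * r powr \<beta>" by (simp add: d_def flip: powr_add)
  ultimately show ?thesis using that[of r] r by (simp add: r_def mult.assoc)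
qed

text \<open>For exponent 0 only the zero polynomial is admissible and the condition says that
  \<open>f\<close> is bounded. This keeps the set defining the lower exponent nonempty.\<close>

lemma holder_at_zero:
  assumes f: "continuous_on {0..1} f"
  shows "holder_at {0..1} f 0 t"
proof -
  have "compact (f ` {0..1})" using f by (intro compact_continuous_image) auto
  then obtain C where C: "C > 0" "\<And>x. x \<in> {0..1} \<Longrightarrow> \<bar>f x\<bar> \<le> C"
    using compact_imp_bounded bounded_pos[of "f ` {0..1}"] by auto
  have "Linf_norm (rel_ball {0..1} t r) (\<lambda>x. f x - poly 0 x) \<le> ennreal (C * r powr 0)" if "0 < r" for r
    using C that continuous_on_subset[OF f rel_ball_subset] rel_ball_lebesgue[of "{0..1}" t r]
    by (intro Linf_norm_le continuous_intros) (auto simp: mem_rel_ball)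
  then show ?thesis
    unfolding holder_at_def using C(1) by (intro exI[of _ C] conjI exI[of _ 1] exI[of _ 0]) auto
qed

lemma lower_holder_exp_nonneg:
  assumes "continuous_on {0..1} f" shows "lower_holder_exp {0..1} f t \<ge> 0"
  unfolding lower_holder_exp_def zero_ereal_def
  using holder_at_zero[OF assms] by (intro Sup_upper) auto

text \<open>Each of the two hypotheses is used for both exponents. \<open>regular\<close> bounds the
  lower exponent from below directly, and the upper one because it contradicts large oscillation.
  \<open>irregular\<close> bounds the upper exponent from above directly, and the lower one because
  large second differences rule out a good affine approximation. An intermediate exponent absorbs
  the constants each time.\<close>

lemma holder_exponents_eqI:
  assumes f: "continuous_on {0..1} f" and t: "t \<in> {0..1}" and H: "0 \<le> H" "H \<le> 1"
    and regular: "\<And>\<alpha>. 0 < \<alpha> \<Longrightarrow> \<alpha> < H \<Longrightarrow>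
      \<exists>C>0. \<exists>R>0. \<forall>x\<in>{0..1}. \<bar>x - t\<bar> < R \<longrightarrow> \<bar>f x - f t\<bar> \<le> C * \<bar>x - t\<bar> powr \<alpha>"
    and irregular: "\<And>\<beta>. H < \<beta> \<Longrightarrow> \<beta> < 2 \<Longrightarrow>
      \<exists>C>0. \<exists>R>0. \<forall>r. 0 < r \<and> r \<le> R \<longrightarrow> (\<exists>x h. 0 < h \<and> 2 * h < r \<and> x \<in> rel_ball {0..1} t r \<and>
        x + 2 * h \<in> rel_ball {0..1} t r \<and> C * r powr \<beta> \<le> \<bar>f (x + 2 * h) - 2 * f (x + h) + f x\<bar>)"
  shows "lower_holder_exp {0..1} f t = ereal H" "upper_holder_exp {0..1} f t = ereal H"
proof -
  have "ereal H \<le> lower_holder_exp {0..1} f t"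
  proof (rule ccontr)
    assume "\<not> ?thesis"
    then obtain z where z: "lower_holder_exp {0..1} f t < ereal z" "ereal z < ereal H"
      using ereal_dense2 by (meson not_le)
    then have "ereal 0 < ereal z"
      using le_less_trans[OF lower_holder_exp_nonneg[OF f, of t] z(1)] by simp
    then have "holder_at {0..1} f z t"
      using regular[of z] z(2) holder_atI[OF f t, of z] by auto
    then have "ereal z \<le> lower_holder_exp {0..1} f t"
      unfolding lower_holder_exp_def using \<open>ereal 0 < ereal z\<close> by (intro Sup_upper) auto
    then show False using z(1) by auto
  qed
  moreover have "lower_holder_exp {0..1} f t \<le> ereal H"
    unfolding lower_holder_exp_def
  proof (rule Sup_least, clarify, rule ccontr)
    fix \<alpha> assume \<alpha>: "0 \<le> \<alpha>" and hol: "holder_at {0..1} f \<alpha> t" and "\<not> ereal \<alpha> \<le> ereal H"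
    then have "H < min \<alpha> 2" using H by auto
    then obtain \<beta> where \<beta>: "H < \<beta>" "\<beta> < min \<alpha> 2" using dense by blast
    obtain C R a b where CR: "C > 0" "R > 0" "R \<le> 1"
      and le: "\<And>r x. 0 < r \<Longrightarrow> r \<le> R \<Longrightarrow> x \<in> {0..1} \<Longrightarrow> \<bar>x - t\<bar> < r \<Longrightarrow>
       \<bar>f x - (a + b * (x - t))\<bar> \<le> C * r powr (min \<alpha> 2)"
      using holder_at_affine[OF f t \<alpha> hol] by metis
    obtain c R' where c: "c > 0" "R' > 0" and
      ge: "\<And>r. 0 < r \<Longrightarrow> r \<le> R' \<Longrightarrow> \<exists>x h. 0 < h \<and> 2 * h < r \<and> x \<in> rel_ball {0..1} t r \<and>
        x + 2 * h \<in> rel_ball {0..1} t r \<and> c * r powr \<beta> \<le> \<bar>f (x + 2 * h) - 2 * f (x + h) + f x\<bar>"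
      using irregular[of \<beta>] \<beta> by auto
    \<comment> \<open>The factor 4 is the sum of the moduli of the coefficients 1, -2, 1 of a second
      difference.\<close>
    obtain r where r: "0 < r" "r \<le> min R R'" "4 * C * r powr (min \<alpha> 2) < c * r powr \<beta>"
      using powr_eventually_less[OF \<beta>(2), of "4 * C" c "min R R'"] CR c by auto
    obtain x h where xh: "0 < h" "x \<in> rel_ball {0..1} t r" "x + 2 * h \<in> rel_ball {0..1} t r"
      "c * r powr \<beta> \<le> \<bar>f (x + 2 * h) - 2 * f (x + h) + f x\<bar>"
      using ge[of r] r by auto
    define g where "g y = f y - (a + b * (y - t))" for y
    have "x + h \<in> rel_ball {0..1} t r" using xh by (auto simp: mem_rel_ball)
    then have "\<bar>g x\<bar> \<le> C * r powr (min \<alpha> 2)" "\<bar>g (x + h)\<bar> \<le> C * r powr (min \<alpha> 2)"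
      "\<bar>g (x + 2 * h)\<bar> \<le> C * r powr (min \<alpha> 2)"
      using xh r unfolding g_def by (auto simp: mem_rel_ball intro!: le)
    moreover have "f (x + 2 * h) - 2 * f (x + h) + f x = g (x + 2 * h) - 2 * g (x + h) + g x"
      by (simp add: g_def algebra_simps)
    ultimately show False using xh(4) r(3) by linarith
  qed
  ultimately show "lower_holder_exp {0..1} f t = ereal H" by (rule antisym[rotated])
  have "upper_holder_exp {0..1} f t \<le> ereal H"
  proof (rule ccontr)
    assume "\<not> ?thesis"
    then obtain z where z: "ereal z < upper_holder_exp {0..1} f t" "ereal H < ereal z"
      using ereal_dense2 by (meson not_le)
    \<comment> \<open>\<open>irregular\<close> only speaks of exponents below 2; 3/2 is still above
      \<open>H\<close>, as \<open>H \<le> 1\<close>.\<close>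
    define y where "y = min z (3/2)"
    have y: "H < y" "y < 2" "0 \<le> y" using z H by (auto simp: y_def)
    obtain c R where c: "c > 0" "R > 0" and
      ge: "\<And>r. 0 < r \<Longrightarrow> r \<le> R \<Longrightarrow> \<exists>x h. 0 < h \<and> 2 * h < r \<and> x \<in> rel_ball {0..1} t r \<and>
        x + 2 * h \<in> rel_ball {0..1} t r \<and> c * r powr y \<le> \<bar>f (x + 2 * h) - 2 * f (x + h) + f x\<bar>"
      using irregular[OF y(1,2)] by auto
    then have "irregular_at {0..1} f y t"
      using y by (intro irregular_atI[OF f t, of y c "min R 1"]) auto
    then have "upper_holder_exp {0..1} f t \<le> ereal y"
      unfolding upper_holder_exp_def using y by (intro Inf_lower) auto
    also have "\<dots> \<le> ereal z" by (simp add: y_def)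
    finally show False using z by auto
  qed
  moreover have "ereal H \<le> upper_holder_exp {0..1} f t"
    unfolding upper_holder_exp_def
  proof (rule Inf_greatest, clarify, rule ccontr)
    fix \<alpha> assume \<alpha>: "0 \<le> \<alpha>" and irr: "irregular_at {0..1} f \<alpha> t" and "\<not> ereal H \<le> ereal \<alpha>"
    then have "\<alpha> < H" by auto
    then obtain \<beta> where \<beta>: "\<alpha> < \<beta>" "\<beta> < H" using dense by blast
    obtain C R where CR: "C > 0" "R > 0"
      and le: "\<And>x. x \<in> {0..1} \<Longrightarrow> \<bar>x - t\<bar> < R \<Longrightarrow> \<bar>f x - f t\<bar> \<le> C * \<bar>x - t\<bar> powr \<beta>"
      using regular[of \<beta>] \<alpha> \<beta> by auto
    obtain c R' where c: "c > 0" "R' > 0" and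
      ge: "\<And>r. 0 < r \<Longrightarrow> r \<le> R' \<Longrightarrow> \<exists>x\<in>{0..1}. \<bar>x - t\<bar> < r \<and> \<bar>f x - f t\<bar> \<ge> c * r powr \<alpha>"
      using irregular_at_osc[OF f t \<alpha> _ irr] \<open>\<alpha> < H\<close> H by auto
    obtain r where r: "0 < r" "r \<le> min R R'" "C * r powr \<beta> < c * r powr \<alpha>"
      using powr_eventually_less[OF \<beta>(1), of C c "min R R'"] CR c by auto
    obtain x where x: "x \<in> {0..1}" "\<bar>x - t\<bar> < r" "\<bar>f x - f t\<bar> \<ge> c * r powr \<alpha>" using ge[of r] r by auto
    have "\<bar>f x - f t\<bar> \<le> C * \<bar>x - t\<bar> powr \<beta>" using le[of x] x r by auto
    also have "\<dots> \<le> C * r powr \<beta>" using x CR \<alpha> \<beta> by (intro mult_left_mono powr_mono2) auto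
    finally show False using x r by linarith
  qed
  ultimately show "upper_holder_exp {0..1} f t = ereal H" by (rule antisym)
qed

section \<open>The exponent of a nowhere differentiable function is of the first Baire class\<close>

text \<open>The affine approximant has an error of order greater than 1 in the distance to
  \<open>t\<close>, so its slope is the derivative. Consequently a nowhere differentiable function
  has no exponent above 1.\<close>

lemma holder_at_imp_differentiable:
  assumes f: "continuous_on {0..1} f" and t: "t \<in> {0..1}" and "\<alpha> > 1"
    and hol: "holder_at {0..1} f \<alpha> t"
  shows "f differentiable (at t within {0..1})"
proof -
  define \<gamma> where "\<gamma> = min \<alpha> 2"
  have \<gamma>: "\<gamma> > 1" and \<alpha>0: "\<alpha> \<ge> 0" using \<open>\<alpha> > 1\<close> by (auto simp: \<gamma>_def)
  obtain C R a b where CR: "C > 0" "R > 0"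
    and le: "\<And>r x. 0 < r \<Longrightarrow> r \<le> R \<Longrightarrow> x \<in> {0..1} \<Longrightarrow> \<bar>x - t\<bar> < r \<Longrightarrow>
       \<bar>f x - (a + b * (x - t))\<bar> \<le> C * r powr (min \<alpha> 2)"
    using holder_at_affine[OF f t \<alpha>0 hol] by metis
  note le = le[folded \<gamma>_def]
  \<comment> \<open>The bound at \<open>x = t\<close> holds for all small \<open>r\<close>, and its
    right side tends to 0.\<close>
  have a: "f t = a"
  proof (rule ccontr)
    assume "f t \<noteq> a"
    then obtain r where "0 < r" "r \<le> R" "C * r powr \<gamma> < \<bar>f t - a\<bar> * r powr 0"
      using powr_eventually_less[of 0 \<gamma> C "\<bar>f t - a\<bar>" R] \<gamma> CR by auto
    then show False using le[of r t] t by auto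
  qed
  have "((\<lambda>x. (f x - f t) / (x - t) - b) \<longlongrightarrow> 0) (at t within {0..1})"
  proof (rule Lim_null_comparison)
    have "\<forall>\<^sub>F x in at t within {0..1}. x \<in> {0..1} \<and> x \<noteq> t \<and> dist x t < R / 2"
      unfolding eventually_at using CR by (intro exI[of _ "R / 2"]) auto
    then show "\<forall>\<^sub>F x in at t within {0..1}. norm ((f x - f t) / (x - t) - b) \<le> C * 2 powr \<gamma> * \<bar>x - t\<bar> powr (\<gamma> - 1)"
    proof eventually_elim
      case (elim x)
      define d where "d = \<bar>x - t\<bar>"
      have d: "d > 0" "d < R / 2" using elim by (auto simp: d_def dist_real_def)
      \<comment> \<open>Balls are open, so radius \<open>2 * d\<close> is used to reach
        \<open>x\<close>; it does not exceed \<open>R\<close> since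
        \<open>d < R / 2\<close>.\<close>
      have "\<bar>f x - (a + b * (x - t))\<bar> \<le> C * (2 * d) powr \<gamma>"
        using le[of "2 * d" x] elim d by (auto simp: d_def)
      also have "\<dots> = (C * 2 powr \<gamma> * d powr (\<gamma> - 1)) * d"
        using d by (simp add: powr_mult powr_diff)
      finally have "\<bar>f x - (a + b * (x - t))\<bar> / d \<le> C * 2 powr \<gamma> * d powr (\<gamma> - 1)"
        using d by (simp add: pos_divide_le_eq)
      moreover have "(f x - f t) / (x - t) - b = (f x - (a + b * (x - t))) / (x - t)"
        using elim a by (simp add: field_simps)
      ultimately show ?case by (simp add: d_def abs_divide)
    qed
    have "((\<lambda>x. \<bar>x - t\<bar> powr (\<gamma> - 1)) \<longlongrightarrow> \<bar>t - t\<bar> powr (\<gamma> - 1)) (at t within {0..1})"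
      using \<gamma> by (intro tendsto_powr2 tendsto_intros) auto
    then show "((\<lambda>x. C * 2 powr \<gamma> * \<bar>x - t\<bar> powr (\<gamma> - 1)) \<longlongrightarrow> 0) (at t within {0..1})"
      by (intro tendsto_mult_right_zero) simp
  qed
  then have "((\<lambda>x. (f x - f t) / (x - t)) \<longlongrightarrow> b) (at t within {0..1})"
    by (simp add: LIM_zero_iff)
  then have "(f has_real_derivative b) (at t within {0..1})"
    by (simp add: has_field_derivative_iff)
  then show ?thesis by (auto simp: real_differentiable_def)
qed

text \<open>The oscillation is a supremum over the fixed parameter set \<open>{-1..1}\<close>, with \<^term>\<open>f\<close>
  extended by constants, so that it is visibly continuous in \<^term>\<open>t\<close>.\<close>

definition osc :: "(real \<Rightarrow> real) \<Rightarrow> real \<Rightarrow> real \<Rightarrow> real" where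
  "osc f r t = (SUP u\<in>{-1..1}. \<bar>f (max 0 (min 1 (t + r * u))) - f (max 0 (min 1 t))\<bar>)"

lemma bdd_above_osc:
  fixes f :: "real \<Rightarrow> real"
  assumes f: "continuous_on {0..1::real} f"
  shows "bdd_above ((\<lambda>u::real. \<bar>f (max 0 (min 1 (t + r * u))) - f (max 0 (min 1 t))\<bar>) ` {-1..1})"
proof -
  have "compact (f ` {0..1})" using f by (intro compact_continuous_image) auto
  then obtain C where C: "C > 0" "\<And>x. x \<in> {0..1} \<Longrightarrow> \<bar>f x\<bar> \<le> C"
    using compact_imp_bounded bounded_pos[of "f ` {0..1}"] by auto
  have "\<bar>f (max 0 (min 1 x)) - f (max 0 (min 1 y))\<bar> \<le> 2 * C" for x y
  proof -
    have "\<bar>u - v\<bar> \<le> 2 * C" if "\<bar>u\<bar> \<le> C" "\<bar>v\<bar> \<le> C" for u v using that by linarith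
    then show ?thesis using C(2) by simp
  qed
  then show ?thesis by (intro bdd_aboveI2[of _ _ "2 * C"]) auto
qed

lemma osc_ge:
  assumes f: "continuous_on {0..1} f" and "t \<in> {0..1}" "x \<in> {0..1}" "\<bar>x - t\<bar> \<le> r" "r > 0"
  shows "\<bar>f x - f t\<bar> \<le> osc f r t"
proof -
  have "\<bar>(x - t) / r\<bar> \<le> 1" using assms by simp
  then have "(x - t) / r \<in> {-1..1}" unfolding atLeastAtMost_iff by linarith
  then have "\<bar>f (max 0 (min 1 (t + r * ((x - t) / r)))) - f (max 0 (min 1 t))\<bar> \<le> osc f r t"
    unfolding osc_def by (intro cSUP_upper bdd_above_osc[OF f])
  then show ?thesis using assms by simp
qed

lemma abs_clamp_diff_le: "\<bar>max 0 (min 1 x) - max 0 (min 1 y)\<bar> \<le> \<bar>x - y\<bar>" for x y :: real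
  by linarith

lemma osc_le:
  assumes "t \<in> {0..1}" "r > 0" "\<And>x. x \<in> {0..1} \<Longrightarrow> \<bar>x - t\<bar> \<le> r \<Longrightarrow> \<bar>f x - f t\<bar> \<le> M"
  shows "osc f r t \<le> M"
  unfolding osc_def
proof (rule cSUP_least)
  fix u :: real assume u: "u \<in> {-1..1}"
  have "\<bar>r * u\<bar> \<le> r" using u assms(2) by (simp add: abs_mult abs_le_iff)
  then have "\<bar>max 0 (min 1 (t + r * u)) - t\<bar> \<le> r"
    using abs_clamp_diff_le[of "t + r * u" t] assms(1) by simp
  then show "\<bar>f (max 0 (min 1 (t + r * u))) - f (max 0 (min 1 t))\<bar> \<le> M"
    using assms(3)[of "max 0 (min 1 (t + r * u))"] assms(1) by simp
qed auto

text \<open>The parameter \<open>u\<close> ranges over a set independent of \<open>t\<close>. A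
  shift of \<open>t\<close> by less than \<open>d\<close> changes each of the two values of
  \<open>F\<close> by less than \<open>e / 4\<close>, hence the supremum by at most
  \<open>e / 2\<close>, in either direction.\<close>

lemma continuous_on_osc:
  assumes f: "continuous_on {0..1} f" shows "continuous_on S (osc f r)"
  unfolding continuous_on_iff
proof (intro ballI allI impI)
  fix t and e :: real assume "e > 0"
  have "uniformly_continuous_on {0..1} f" using f by (intro compact_uniformly_continuous) auto
  then obtain d where d: "d > 0"
    "\<And>x y. x \<in> {0..1} \<Longrightarrow> y \<in> {0..1} \<Longrightarrow> \<bar>x - y\<bar> < d \<Longrightarrow> \<bar>f x - f y\<bar> < e / 4"
    using \<open>e > 0\<close> unfolding uniformly_continuous_on_def dist_real_def
    by (auto dest!: spec[of _ "e / 4"])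
  define F where "F x = f (max 0 (min 1 x))" for x
  have clamp: "\<bar>F x - F y\<bar> < e / 4" if "\<bar>x - y\<bar> < d" for x y
    unfolding F_def using le_less_trans[OF abs_clamp_diff_le that] by (intro d(2)) auto
  have le: "osc f r s \<le> osc f r s' + e / 2" if "\<bar>s - s'\<bar> < d" for s s'
    unfolding osc_def[of f r s, folded F_def]
  proof (rule cSUP_least)
    fix u :: real assume u: "u \<in> {-1..1}"
    have "\<bar>F (s' + r * u) - F s'\<bar> \<le> osc f r s'"
      unfolding osc_def F_def using u by (intro cSUP_upper bdd_above_osc[OF f])
    moreover have "\<bar>(s + r * u) - (s' + r * u)\<bar> < d" using that by simp
    ultimately show "\<bar>F (s + r * u) - F s\<bar> \<le> osc f r s' + e / 2"
      using clamp[OF that] clamp[of "s + r * u" "s' + r * u"] by linarith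
  qed auto
  show "\<exists>d>0. \<forall>x'\<in>S. dist x' t < d \<longrightarrow> dist (osc f r x') (osc f r t) < e"
  proof (intro exI[of _ d] conjI ballI impI)
    fix s assume "dist s t < d"
    then have "\<bar>s - t\<bar> < d" "\<bar>t - s\<bar> < d" by (auto simp: dist_real_def)
    then show "dist (osc f r s) (osc f r t) < e"
      using le[of s t] le[of t s] \<open>e > 0\<close> by (simp add: dist_real_def abs_real_def)
  qed (use d in auto)
qed

text \<open>Vanishing oscillation would make \<open>f\<close> constant near \<open>t\<close>, hence
  differentiable there. Positivity is what makes the logarithm of the oscillation
  continuous.\<close>

lemma osc_pos:
  assumes f: "continuous_on {0..1} f" and t: "t \<in> {0..1}" and "r > 0"
    and nd: "\<not> f differentiable (at t within {0..1})"
  shows "osc f r t > 0"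
proof (rule ccontr)
  assume *: "\<not> ?thesis"
  have eq: "f x = f t" if "x \<in> {0..1}" "\<bar>x - t\<bar> < r" for x
    using osc_ge[OF f t that(1), of r] that * \<open>r > 0\<close> by auto
  have "f differentiable (at t within {0..1})"
  proof (rule differentiable_transform_within)
    show "(\<lambda>x. f t) differentiable (at t within {0..1})" by simp
    show "f t = f x" if "x \<in> {0..1}" "dist x t < r" for x
      using eq[of x] that by (simp add: dist_real_def)
  qed (use assms in auto)
  then show False using nd by simp
qed

section \<open>Logarithmic quotients of the oscillation\<close>

text \<open>Hoelder bounds limit the oscillation from above and irregularity limits it from below.
  Dividing logarithms by the negative \<open>ln (r j)\<close> reverses these inequalities and makes
  the multiplicative constants vanish in the limit. Agreement of the two exponents squeezes the
  quotient.\<close>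

lemma osc_exponent_tendsto:
  assumes f: "continuous_on {0..1} f" and t: "t \<in> {0..1}"
    and nd: "\<not> f differentiable (at t within {0..1})"
    and eq: "lower_holder_exp {0..1} f t = upper_holder_exp {0..1} f t"
  obtains l where "upper_holder_exp {0..1} f t = ereal l"
    "(\<lambda>j. max 0 (min 1 (ln (osc f ((1/2) ^ Suc j) t) / ln ((1/2) ^ Suc j)))) \<longlonglongrightarrow> l"
proof -
  \<comment> \<open>The exponent \<open>Suc j\<close> makes \<open>ln (r j)\<close> nonzero already
    for \<open>j = 0\<close>.\<close>
  define r :: "nat \<Rightarrow> real" where "r j = (1/2) ^ Suc j" for j
  have r: "r j > 0" "ln (r j) < 0" for j
    by (auto simp: r_def ln_less_zero_iff power_Suc_less_one simp del: power_Suc)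
  have r0: "r \<longlonglongrightarrow> 0" unfolding r_def by real_asymp
  have lnr: "(\<lambda>j. K / ln (r j) + \<alpha>) \<longlonglongrightarrow> \<alpha>" for K \<alpha> unfolding r_def by real_asymp
  have pos: "osc f (r j) t > 0" for j using osc_pos[OF f t r(1) nd] .
  have le1: "\<alpha> \<le> 1" if "holder_at {0..1} f \<alpha> t" for \<alpha>
    using holder_at_imp_differentiable[OF f t _ that] nd by force
  then have "lower_holder_exp {0..1} f t \<le> ereal 1"
    unfolding lower_holder_exp_def by (intro Sup_least) auto
  moreover have "lower_holder_exp {0..1} f t \<ge> ereal 0"
    using lower_holder_exp_nonneg[OF f] by (simp add: zero_ereal_def)
  ultimately obtain l where l: "lower_holder_exp {0..1} f t = ereal l" "0 \<le> l" "l \<le> 1"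
    by (cases "lower_holder_exp {0..1} f t") auto
  have "(\<lambda>j. max 0 (min 1 (ln (osc f (r j) t) / ln (r j)))) \<longlonglongrightarrow> l"
  proof (rule order_tendstoI)
    fix a assume "a < l"
    show "\<forall>\<^sub>F j in sequentially. a < max 0 (min 1 (ln (osc f (r j) t) / ln (r j)))"
    \<comment> \<open>For negative \<open>a\<close> the truncation at 0 decides. Otherwise the
      Hoelder exponent chosen above \<open>a\<close> is positive and at most 1, so the approximant
      is constant.\<close>
    proof (cases "a < 0")
      case False
      have "ereal a < lower_holder_exp {0..1} f t" using l \<open>a < l\<close> by simp
      then obtain \<alpha> where \<alpha>: "a < \<alpha>" "holder_at {0..1} f \<alpha> t"
        unfolding lower_holder_exp_def by (auto simp: less_Sup_iff)
      have "0 < \<alpha>" "\<alpha> \<le> 1" using \<alpha> False le1 by auto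
      then obtain C R where CR: "C > 0" "R > 0"
        and le: "\<And>r x. 0 < r \<Longrightarrow> r \<le> R \<Longrightarrow> x \<in> {0..1} \<Longrightarrow> \<bar>x - t\<bar> < r \<Longrightarrow> \<bar>f x - f t\<bar> \<le> C * r powr \<alpha>"
        using holder_at_le_one[OF f t _ _ \<alpha>(2)] by metis
      define K where "K = C * 2 powr \<alpha>"
      have "K > 0" using CR by (simp add: K_def)
      have "\<forall>\<^sub>F j in sequentially. r j < R / 2" using r0 CR by (intro order_tendstoD) auto
      moreover have "\<forall>\<^sub>F j in sequentially. a < ln K / ln (r j) + \<alpha>"
        using lnr \<alpha>(1) by (rule order_tendstoD)
      ultimately show ?thesis
      proof eventually_elim
        case (elim j)
        \<comment> \<open>\<open>osc\<close> uses a closed ball and the Hoelder bound an open one,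
          hence the doubled radius.\<close>
        have "osc f (r j) t \<le> C * (2 * r j) powr \<alpha>"
          using elim r(1)[of j] by (intro osc_le t le) auto
        also have "\<dots> = K * r j powr \<alpha>" using r[of j] by (simp add: K_def powr_mult)
        finally have "ln (osc f (r j) t) \<le> ln (K * r j powr \<alpha>)"
          using pos by (intro ln_mono) auto
        also have "\<dots> = ln K + \<alpha> * ln (r j)"
          using \<open>K > 0\<close> r(1)[of j] by (simp add: ln_mult ln_powr)
        finally have "ln (osc f (r j) t) / ln (r j) \<ge> (ln K + \<alpha> * ln (r j)) / ln (r j)"
          using r(2)[of j] by (simp add: divide_right_mono_neg)
        also have "(ln K + \<alpha> * ln (r j)) / ln (r j) = ln K / ln (r j) + \<alpha>"
          using r(2)[of j] by (simp add: add_divide_distrib)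
        finally show ?case using elim \<alpha> \<open>\<alpha> \<le> 1\<close> by auto
      qed
    qed (auto intro!: always_eventually)
  next
    fix a assume "l < a"
    show "\<forall>\<^sub>F j in sequentially. max 0 (min 1 (ln (osc f (r j) t) / ln (r j))) < a"
    \<comment> \<open>Above 1 the truncation decides. Otherwise the exponent chosen below
      \<open>a\<close> is less than 1, where irregularity concerns first differences.\<close>
    proof (cases "1 < a")
      case False
      have "upper_holder_exp {0..1} f t < ereal a" using l \<open>l < a\<close> eq by simp
      then obtain \<alpha> where \<alpha>: "\<alpha> < a" "0 \<le> \<alpha>" "irregular_at {0..1} f \<alpha> t"
        unfolding upper_holder_exp_def by (auto simp: Inf_less_iff)
      have "\<alpha> < 1" using \<alpha> False by auto
      then obtain C R where CR: "C > 0" "R > 0" and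
        ge: "\<And>r. 0 < r \<Longrightarrow> r \<le> R \<Longrightarrow> \<exists>x\<in>{0..1}. \<bar>x - t\<bar> < r \<and> \<bar>f x - f t\<bar> \<ge> C * r powr \<alpha>"
        using irregular_at_osc[OF f t \<alpha>(2) _ \<alpha>(3)] by metis
      have "\<forall>\<^sub>F j in sequentially. r j < R" using r0 CR by (intro order_tendstoD) auto
      moreover have "\<forall>\<^sub>F j in sequentially. ln C / ln (r j) + \<alpha> < a"
        using lnr \<alpha>(1) by (rule order_tendstoD)
      ultimately show ?thesis
      proof eventually_elim
        case (elim j)
        obtain x where x: "x \<in> {0..1}" "\<bar>x - t\<bar> < r j" "\<bar>f x - f t\<bar> \<ge> C * r j powr \<alpha>"
          using ge[of "r j"] elim r(1)[of j] by auto
        have "C * r j powr \<alpha> \<le> osc f (r j) t"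
          using osc_ge[OF f t x(1), of "r j"] x r(1)[of j] by simp
        then have "ln (C * r j powr \<alpha>) \<le> ln (osc f (r j) t)"
          using CR r(1)[of j] by (intro ln_mono) auto
        moreover have "ln (C * r j powr \<alpha>) = ln C + \<alpha> * ln (r j)"
          using CR r(1)[of j] by (simp add: ln_mult ln_powr)
        ultimately have "ln (osc f (r j) t) / ln (r j) \<le> (ln C + \<alpha> * ln (r j)) / ln (r j)"
          using r(2)[of j] by (simp add: divide_right_mono_neg)
        also have "(ln C + \<alpha> * ln (r j)) / ln (r j) = ln C / ln (r j) + \<alpha>"
          using r(2)[of j] by (simp add: add_divide_distrib)
        finally show ?case using elim \<alpha> by auto
      qed
    qed (auto intro!: always_eventually)
  qed
  then show ?thesis using that[of l] l eq by (simp add: r_def)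
qed

lemma exponent_baire_one:
  assumes f: "continuous_on {0..1} f"
    and nd: "\<And>t. t \<in> {0..1} \<Longrightarrow> \<not> f differentiable (at t within {0..1})"
    and eq: "\<And>t. t \<in> {0..1} \<Longrightarrow> lower_holder_exp {0..1} f t = upper_holder_exp {0..1} f t"
  obtains H :: "nat \<Rightarrow> real \<Rightarrow> real" where
    "\<And>j. continuous_on {0..1} (H j)" "\<And>j. H j \<in> {0..1} \<rightarrow> {0..1}"
    "\<And>t. t \<in> {0..1} \<Longrightarrow> \<exists>l. (\<lambda>j. H j t) \<longlonglongrightarrow> l \<and> upper_holder_exp {0..1} f t = ereal l"
proof
  define H where "H j t = max 0 (min 1 (ln (osc f ((1/2) ^ Suc j) t) / ln ((1/2) ^ Suc j)))" for j :: nat and t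
  show "continuous_on {0..1} (H j)" for j
  proof -
    have "osc f ((1/2) ^ Suc j) t \<noteq> 0" if "t \<in> {0..1}" for t
      using osc_pos[OF f that _ nd[OF that], of "(1/2) ^ Suc j"] by simp
    moreover have "ln ((1/2) ^ Suc j) < (0::real)"
      by (simp add: ln_less_zero_iff power_Suc_less_one del: power_Suc)
    ultimately show ?thesis
      unfolding H_def by (intro continuous_intros continuous_on_osc[OF f]) (auto simp del: power_Suc)
  qed
  show "H j \<in> {0..1} \<rightarrow> {0..1}" for j by (auto simp: H_def)
  show "\<exists>l. (\<lambda>j. H j t) \<longlonglongrightarrow> l \<and> upper_holder_exp {0..1} f t = ereal l" if "t \<in> {0..1}" for t
    unfolding H_def using osc_exponent_tendsto[OF f that nd[OF that] eq[OF that]] by metis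
qed

section \<open>Faber--Schauder series\<close>

text \<open>The distance to the nearest integer. Its peak 1/2 is the normalisation for which the
  second difference over one cell is exactly minus the coefficient.\<close>

definition tri :: "real \<Rightarrow> real" where
  "tri y = min (frac y) (1 - frac y)"

lemma tri_nonneg: "0 \<le> tri y" and tri_le_one: "tri y \<le> 1"
  using frac_ge_0[of y] frac_lt_1[of y] unfolding tri_def by linarith+

lemma tri_on_cell:
  assumes "of_int q \<le> y" "y \<le> of_int q + 1"
  shows "tri y = min (y - of_int q) (of_int q + 1 - y)"
proof (cases "y = of_int q + 1")
  case True
  then have "y = of_int (q + 1)" by simp
  then have "frac y = 0" by (metis frac_of_int)
  then show ?thesis using True by (simp add: tri_def)
next
  case False
  then have "\<lfloor>y\<rfloor> = q" using assms by (intro floor_unique) auto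
  then show ?thesis by (simp add: tri_def frac_def algebra_simps)
qed

text \<open>The left end point of the dyadic cell of generation \<open>j\<close> around
  \<open>x\<close>.\<close>

definition node :: "nat \<Rightarrow> real \<Rightarrow> real" where
  "node j x = of_int \<lfloor>2 ^ j * x\<rfloor> / 2 ^ j"

lemma node_le: "node j x \<le> x"
  by (simp add: node_def pos_divide_le_eq mult.commute)

lemma abs_node_diff_le: "\<bar>node j x - x\<bar> \<le> 1 / 2 ^ j"
proof -
  have "x \<le> (of_int \<lfloor>2 ^ j * x\<rfloor> + 1) / 2 ^ j"
    using floor_correct[of "2 ^ j * x"] by (simp add: pos_le_divide_eq mult.commute)
  then have "x \<le> node j x + 1 / 2 ^ j" by (simp add: node_def add_divide_distrib)
  then show ?thesis using node_le[of j x] by simp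
qed

lemma node_mem: "x \<in> {0..1} \<Longrightarrow> node j x \<in> {0..1}"
proof -
  assume x: "x \<in> {0..1}"
  then have "0 \<le> node j x" by (simp add: node_def)
  then show ?thesis using node_le[of j x] x by simp
qed

text \<open>Coefficients are indexed by the node as a real number, so they can be sampled from
  functions on \<open>{0..1}\<close>.\<close>

definition layer :: "(nat \<Rightarrow> real \<Rightarrow> real) \<Rightarrow> nat \<Rightarrow> real \<Rightarrow> real" where
  "layer c j x = c j (node j x) * tri (2 ^ j * x)"

text \<open>At the right end point of a cell the node jumps, but the hat function vanishes there.\<close>

lemma layer_on_cell:
  assumes "of_int q \<le> 2 ^ j * x" "2 ^ j * x \<le> of_int q + 1"
  shows "layer c j x = c j (of_int q / 2 ^ j) * min (2 ^ j * x - of_int q) (of_int q + 1 - 2 ^ j * x)"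
proof (cases "2 ^ j * x = of_int q + 1")
  case True
  then show ?thesis using tri_on_cell[OF assms] by (simp add: layer_def)
next
  case False
  then have "\<lfloor>2 ^ j * x\<rfloor> = q" using assms by (intro floor_unique) auto
  then show ?thesis using tri_on_cell[OF assms] by (simp add: layer_def node_def)
qed

text \<open>Inside one cell the coefficient is common and the hat is 1-Lipschitz. In different cells
  the coefficients are unrelated, but the hat vanishes at a boundary in between, so both nonnegative
  values are at most \<open>M * (Y - X)\<close>, and so is their difference.\<close>

lemma layer_diff_le_aux:
  assumes c: "0 \<le> c j (node j x)" "c j (node j x) \<le> M" "0 \<le> c j (node j y)" "c j (node j y) \<le> M"
    and "x \<le> y"
  shows "\<bar>layer c j x - layer c j y\<bar> \<le> M * (2 ^ j * (y - x))"
proof -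
  define X Y where "X = 2 ^ j * x" and "Y = 2 ^ j * y"
  have XY: "X \<le> Y" using assms(5) by (simp add: X_def Y_def)
  have M: "0 \<le> M" using c by linarith
  have "\<bar>layer c j x - layer c j y\<bar> \<le> M * (Y - X)"
  proof (cases "\<lfloor>X\<rfloor> = \<lfloor>Y\<rfloor>")
    case True
    then have eq: "node j x = node j y" by (simp add: node_def X_def Y_def)
    have "frac Y - frac X = Y - X" using True by (simp add: frac_def)
    then have "\<bar>tri X - tri Y\<bar> \<le> Y - X" using XY unfolding tri_def by linarith
    then have "c j (node j y) * \<bar>tri X - tri Y\<bar> \<le> M * (Y - X)"
      using c by (intro mult_mono) auto
    moreover have "layer c j x - layer c j y = c j (node j y) * (tri X - tri Y)"
      by (simp add: layer_def eq X_def Y_def algebra_simps)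
    ultimately show ?thesis using c by (simp add: abs_mult)
  next
    case False
    then have "\<lfloor>X\<rfloor> + 1 \<le> \<lfloor>Y\<rfloor>" using floor_mono[OF XY] by linarith
    then have "real_of_int \<lfloor>X\<rfloor> + 1 \<le> of_int \<lfloor>Y\<rfloor>" by linarith
    then have "tri X \<le> Y - X" "tri Y \<le> Y - X"
      using floor_correct[of X] floor_correct[of Y] unfolding tri_def frac_def by linarith+
    then have "0 \<le> layer c j x" "layer c j x \<le> M * (Y - X)" "0 \<le> layer c j y" "layer c j y \<le> M * (Y - X)"
      unfolding layer_def using c M tri_nonneg by (auto simp: X_def Y_def intro!: mult_mono mult_nonneg_nonneg)
    then show ?thesis by linarith
  qed
  then show ?thesis by (simp add: X_def Y_def algebra_simps)
qed

lemma layer_diff_le: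
  assumes "0 \<le> c j (node j x)" "c j (node j x) \<le> M" "0 \<le> c j (node j y)" "c j (node j y) \<le> M"
  shows "\<bar>layer c j x - layer c j y\<bar> \<le> M * (2 ^ j * \<bar>x - y\<bar>)"
proof (cases "x \<le> y")
  case True
  then show ?thesis using layer_diff_le_aux[of c j x M y] assms by simp
next
  case False
  then show ?thesis using layer_diff_le_aux[of c j y M x] assms by (simp add: abs_minus_commute)
qed

text \<open>The three points are the ends and the midpoint of a cell of generation \<open>J\<close>.
  Finer layers vanish at all three, coarser layers are affine between them, and layer
  \<open>J\<close> contributes its peak alone.\<close>

lemma layer_second_difference:
  fixes k :: nat
  assumes x: "x = real k / 2 ^ J" and h: "h = 1 / 2 ^ Suc J"
  shows "layer c j (x + 2 * h) - 2 * layer c j (x + h) + layer c j x = (if j = J then - c J x else 0)"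
proof (cases "j \<le> J")
  case False
  define p :: nat where "p = 2 ^ (j - Suc J)"
  have "(2::real) ^ j = real p * 2 ^ Suc J"
  proof -
    have "(2::real) ^ j = 2 ^ (j - Suc J + Suc J)" using False by simp
    then show ?thesis by (simp only: p_def power_add of_nat_power of_nat_numeral)
  qed
  then have "2 ^ j * x = of_int (int (2 * k * p))" "2 ^ j * (x + h) = of_int (int ((2 * k + 1) * p))"
    "2 ^ j * (x + 2 * h) = of_int (int ((2 * k + 2) * p))"
    by (simp_all add: x h field_simps)
  then have "tri (2 ^ j * x) = 0" "tri (2 ^ j * (x + h)) = 0" "tri (2 ^ j * (x + 2 * h)) = 0"
    unfolding tri_def by (simp_all only: frac_of_int)
  then show ?thesis using False by (simp add: layer_def)
next
  case True
  \<comment> \<open>A cell of generation \<open>j\<close> consists of \<open>n\<close> cells of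
    generation \<open>J\<close>; \<open>q\<close> numbers the coarse cell and \<open>m\<close> is
    the position within it.\<close>
  define n :: nat where "n = 2 ^ (J - j)"
  define q where "q = int (k div n)"
  define m where "m = k mod n"
  have n: "n > 0" and m: "m < n" by (auto simp: n_def m_def)
  have k: "real k = real n * real_of_int q + real m"
    unfolding q_def m_def by (simp flip: of_nat_mult of_nat_add)
  have "(2::real) ^ J = 2 ^ j * real n" using True by (simp add: n_def flip: power_add)
  then have X: "2 ^ j * x = of_int q + real m / n" "2 ^ j * (x + h) = of_int q + (real m + 1/2) / n"
    "2 ^ j * (x + 2 * h) = of_int q + (real m + 1) / n"
    using n by (simp_all add: x h k field_simps)
  have m1: "real m + 1 \<le> real n" using m by linarith
  then have cell: "0 \<le> real m / n" "real m / n \<le> 1" "0 \<le> (real m + 1/2) / n" "(real m + 1/2) / n \<le> 1"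
    "0 \<le> (real m + 1) / n" "(real m + 1) / n \<le> 1"
    using n by (simp_all add: divide_simps)
  define C where "C = c j (of_int q / 2 ^ j)"
  have L: "layer c j x = C * min (real m / n) (1 - real m / n)"
    "layer c j (x + h) = C * min ((real m + 1/2) / n) (1 - (real m + 1/2) / n)"
    "layer c j (x + 2 * h) = C * min ((real m + 1) / n) (1 - (real m + 1) / n)"
    using layer_on_cell[of q j x c] layer_on_cell[of q j "x + h" c] layer_on_cell[of q j "x + 2 * h" c] cell
    unfolding X C_def by (simp_all add: add.commute)
  show ?thesis
  proof (cases "j = J")
    case True
    then have "n = 1" "m = 0" using m by (auto simp: n_def)
    moreover have "C = c J x" using k True \<open>n = 1\<close> \<open>m = 0\<close> by (simp add: C_def x)
    ultimately show ?thesis using True by (simp add: L[unfolded True])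
  next
    case False
    \<comment> \<open>Half of \<open>n\<close>: comparing \<open>m\<close> with \<open>p\<close>
      tells on which side of its peak the coarse hat is evaluated, and it is affine on each
      side.\<close>
    define p :: nat where "p = 2 ^ (J - Suc j)"
    have "J - j = Suc (J - Suc j)" using False \<open>j \<le> J\<close> by simp
    then have p: "real n = 2 * real p" by (simp add: n_def p_def)
    have half: "v / n \<le> 1 - v / n \<longleftrightarrow> 2 * v \<le> n" "1 - v / n \<le> v / n \<longleftrightarrow> n \<le> 2 * v" for v :: real
      using n by (auto simp: field_simps)
    show ?thesis
    proof (cases "m < p")
      case True
      then have "real m + 1 \<le> p" by linarith
      then have le: "real m / n \<le> 1 - real m / n" "(real m + 1/2) / n \<le> 1 - (real m + 1/2) / n"
        "(real m + 1) / n \<le> 1 - (real m + 1) / n"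
        unfolding half by (simp_all add: p)
      show ?thesis unfolding L le[THEN min_absorb1] using False by (simp add: add_divide_distrib algebra_simps)
    next
      case F: False
      then have "real p \<le> m" by linarith
      then have le: "1 - real m / n \<le> real m / n" "1 - (real m + 1/2) / n \<le> (real m + 1/2) / n"
        "1 - (real m + 1) / n \<le> (real m + 1) / n"
        unfolding half by (simp_all add: p)
      show ?thesis unfolding L le[THEN min_absorb2] using False by (simp add: add_divide_distrib algebra_simps)
    qed
  qed
qed

section \<open>Size and irregularity of a Faber--Schauder series with capped coefficients\<close>

lemma dyadic_scale:
  fixes r :: real
  assumes "0 < r" "r \<le> 1 / 2 ^ J0"
  obtains J where "J0 \<le> J" "1 / 2 ^ Suc J < r" "r \<le> 1 / 2 ^ J"
proof -
  obtain n where n: "(1/2) ^ n < r" using real_arch_pow_inv[of r "1/2"] assms by auto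
  \<comment> \<open>The least such exponent exceeds \<open>J0\<close>, so it has a predecessor, at
    which the strict inequality fails.\<close>
  define m where "m = (LEAST n. (1/2) ^ n < r)"
  have m: "(1/2) ^ m < r" unfolding m_def using n by (rule LeastI)
  have "\<not> m \<le> J0"
  proof
    assume "m \<le> J0"
    then have "(1/2::real) ^ J0 \<le> (1/2) ^ m" by (intro power_decreasing) auto
    then show False using m assms by (simp add: power_one_over)
  qed
  then obtain J where J: "m = Suc J" "J0 \<le> J" by (cases m) auto
  have "\<not> (1/2) ^ J < r" using J(1) not_less_Least[of J "\<lambda>n. (1/2) ^ n < r"] by (simp add: m_def)
  then show ?thesis using that[of J] m J by (simp add: power_one_over)
qed

text \<open>The cap \<open>2 powr (- sqrt j)\<close> is below \<open>1 / 2 ^ J\<close> beyond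
  generation \<open>J\<^sup>2\<close>, yet decays more slowly than every geometric sequence. The
  square in the denominator supplies summability.\<close>

locale schauder_series =
  fixes c :: "nat \<Rightarrow> real \<Rightarrow> real"
  assumes coeff_nonneg: "0 \<le> c j x"
    and coeff_le: "c j x \<le> 2 powr (- sqrt j) / (real j + 1)\<^sup>2"
begin

definition series :: "real \<Rightarrow> real" where
  "series x = (\<Sum>j. layer c j x)"

lemma coeff_le_square: "c j x \<le> 1 / (real j + 1)\<^sup>2"
proof -
  have "2 powr (- sqrt j) \<le> (1::real)" using powr_mono[of "- sqrt j" 0 2] by simp
  then have "2 powr (- sqrt j) / (real j + 1)\<^sup>2 \<le> 1 / (real j + 1)\<^sup>2" by (intro divide_right_mono) auto
  then show ?thesis using coeff_le[of j x] by linarith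
qed

lemma coeff_le_one: "c j x \<le> 1"
  using coeff_le_square[of j x] by (rule order_trans) (simp add: divide_le_eq_1)

lemma layer_nonneg: "0 \<le> layer c j x"
  by (simp add: layer_def coeff_nonneg tri_nonneg)

lemma layer_le_coeff: "layer c j x \<le> c j (node j x)"
  using mult_left_mono[OF tri_le_one coeff_nonneg] by (simp add: layer_def)

lemma summable_inverse_square: "summable (\<lambda>j. 1 / (real j + 1)\<^sup>2)"
  using inverse_power_summable[of 2, where ?'a = real] summable_Suc_iff[of "\<lambda>n. inverse (real n ^ 2)"]
  by (simp add: inverse_eq_divide add.commute)

lemma norm_layer_le: "norm (layer c j x) \<le> 1 / (real j + 1)\<^sup>2"
  using layer_nonneg[of j x] layer_le_coeff[of j x] coeff_le_square[of j "node j x"] by simp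

lemma summable_layer: "summable (\<lambda>j. layer c j x)"
  using summable_inverse_square norm_layer_le by (rule summable_comparison_test')

lemma continuous_layer: "continuous_on UNIV (layer c j)"
  unfolding continuous_on_iff
proof (intro ballI allI impI)
  fix x e :: real assume "e > 0"
  have "dist (layer c j y) (layer c j x) < e" if "dist y x < e / 2 ^ j" for y
  proof -
    have "\<bar>layer c j y - layer c j x\<bar> \<le> 1 * (2 ^ j * \<bar>y - x\<bar>)"
      by (intro layer_diff_le coeff_nonneg coeff_le_one)
    also have "\<dots> < e" using that by (simp add: dist_real_def pos_less_divide_eq mult.commute)
    finally show ?thesis by (simp add: dist_real_def)
  qed
  then show "\<exists>d>0. \<forall>y\<in>UNIV. dist y x < d \<longrightarrow> dist (layer c j y) (layer c j x) < e"
    using \<open>e > 0\<close> by (intro exI[of _ "e / 2 ^ j"]) auto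
qed

lemma continuous_series: "continuous_on S series"
proof -
  have "uniform_limit UNIV (\<lambda>n x. \<Sum>i<n. layer c i x) (\<lambda>x. \<Sum>i. layer c i x) sequentially"
    using norm_layer_le summable_inverse_square by (intro Weierstrass_m_test)
  then have "continuous_on UNIV (\<lambda>x. \<Sum>i. layer c i x)"
    by (rule uniform_limit_theorem[rotated])
      (auto intro!: always_eventually continuous_on_sum continuous_layer)
  then show ?thesis unfolding series_def using continuous_on_subset by blast
qed

lemma series_second_difference:
  fixes k :: nat
  assumes "x = real k / 2 ^ J" "h = 1 / 2 ^ Suc J"
  shows "series (x + 2 * h) - 2 * series (x + h) + series x = - c J x"
proof -
  have "(\<lambda>j. layer c j (x + 2 * h) - 2 * layer c j (x + h) + layer c j x)
      sums (series (x + 2 * h) - 2 * series (x + h) + series x)"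
    unfolding series_def by (intro sums_add sums_diff sums_mult summable_sums summable_layer)
  then have "(\<lambda>j. if j = J then - c J x else 0) sums (series (x + 2 * h) - 2 * series (x + h) + series x)"
    by (simp add: layer_second_difference[OF assms])
  then show ?thesis using sums_single[of J "\<lambda>_. - c J x"] sums_unique2 by blast
qed

text \<open>At each scale \<open>r\<close> the series is tested on a dyadic cell containing
  \<open>t\<close>, where its second difference is a single coefficient. The cell has length at
  least \<open>r / 2\<close>, whence the constant \<open>2 powr (- \<beta>)\<close>.\<close>

lemma series_irregular:
  assumes t: "t \<in> {0..1}" and "0 < \<beta>"
    and ge: "\<And>J s. J0 \<le> J \<Longrightarrow> s \<in> {0..1} \<Longrightarrow> \<bar>s - t\<bar> \<le> 1 / 2 ^ J \<Longrightarrow> 2 powr (- (\<beta> * J)) \<le> c J s"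
  shows "\<exists>C>0. \<exists>R>0. \<forall>r. 0 < r \<and> r \<le> R \<longrightarrow> (\<exists>x h. 0 < h \<and> 2 * h < r \<and> x \<in> rel_ball {0..1} t r \<and>
        x + 2 * h \<in> rel_ball {0..1} t r \<and> C * r powr \<beta> \<le> \<bar>series (x + 2 * h) - 2 * series (x + h) + series x\<bar>)"
proof (rule exI[of _ "2 powr (- \<beta>)"], rule conjI[rotated], rule exI[of _ "1 / 2 ^ J0"], intro conjI allI impI)
  fix r :: real assume "0 < r \<and> r \<le> 1 / 2 ^ J0"
  then have r0: "0 < r" "r \<le> 1 / 2 ^ J0" by auto
  obtain I where I: "J0 \<le> I" "1 / 2 ^ Suc I < r" "r \<le> 1 / 2 ^ I" using dyadic_scale[OF r0] by blast
  \<comment> \<open>One generation further makes the cell strictly shorter than \<open>r\<close>, as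
    required of the step.\<close>
  define J where "J = Suc I"
  have J: "J0 \<le> J" "1 / 2 ^ J < r" "r / 2 \<le> 1 / 2 ^ J" using I by (auto simp: J_def)
  \<comment> \<open>The cap matters for \<open>t = 1\<close>, where it selects the last cell inside
    \<open>{0..1}\<close>.\<close>
  define k where "k = min (nat \<lfloor>2 ^ J * t\<rfloor>) (2 ^ J - 1)"
  have fl: "real (nat \<lfloor>2 ^ J * t\<rfloor>) \<le> 2 ^ J * t" "2 ^ J * t < real (nat \<lfloor>2 ^ J * t\<rfloor>) + 1"
    using t by (auto simp: of_nat_nat)
  have pow: "real (2 ^ J - 1) = 2 ^ J - 1" by (simp add: of_nat_diff)
  have tJ: "2 ^ J * t \<le> 2 ^ J" using t by simp
  have k: "real k \<le> 2 ^ J * t" "2 ^ J * t \<le> real k + 1" "real k + 1 \<le> 2 ^ J"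
    using fl pow tJ unfolding k_def of_nat_min by linarith+
  define x h where "x = real k / 2 ^ J" and "h = (1::real) / 2 ^ Suc J"
  have h: "0 < h" "2 * h = 1 / 2 ^ J" by (auto simp: h_def)
  have x2h: "x + 2 * h = (real k + 1) / 2 ^ J" by (simp add: h x_def add_divide_distrib)
  have xt: "x \<le> t" "t \<le> x + 2 * h" "0 \<le> x" "x + 2 * h \<le> 1"
    using k unfolding x2h by (auto simp: x_def field_simps)
  show "\<exists>x h. 0 < h \<and> 2 * h < r \<and> x \<in> rel_ball {0..1} t r \<and> x + 2 * h \<in> rel_ball {0..1} t r \<and>
      2 powr (- \<beta>) * r powr \<beta> \<le> \<bar>series (x + 2 * h) - 2 * series (x + h) + series x\<bar>"
  proof (rule exI[of _ x], rule exI[of _ h], intro conjI)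
    show "0 < h" "2 * h < r" using h J by auto
    then show "x \<in> rel_ball {0..1} t r" "x + 2 * h \<in> rel_ball {0..1} t r"
      using xt by (auto simp: mem_rel_ball)
    have "2 powr (- \<beta>) * r powr \<beta> = (r / 2) powr \<beta>"
      using r0 by (simp add: powr_divide powr_minus_divide)
    also have "\<dots> \<le> (1 / 2 ^ J) powr \<beta>" using J r0 \<open>0 < \<beta>\<close> by (intro powr_mono2) auto
    also have "\<dots> = 2 powr (- (\<beta> * J))"
      by (simp add: powr_divide powr_minus_divide powr_powr mult.commute flip: powr_realpow)
    also have "\<dots> \<le> c J x" using xt h J by (intro ge) auto
    finally show "2 powr (- \<beta>) * r powr \<beta> \<le> \<bar>series (x + 2 * h) - 2 * series (x + h) + series x\<bar>"
      using series_second_difference[OF x_def h_def] coeff_nonneg[of J x] by simp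
  qed
qed auto

text \<open>Let \<open>J\<close> be the dyadic scale of \<open>\<bar>x - t\<bar>\<close>.
  Generations up to \<open>J\<close> are estimated by their Lipschitz constants, later ones by their
  coefficients: through \<open>decay\<close> as far as \<open>J\<^sup>2\<close>, and through the cap
  from there on.\<close>

lemma series_regular:
  assumes t: "t \<in> {0..1}" and \<alpha>: "0 < \<alpha>" "\<alpha> < 1"
    and decay: "\<And>J j s. J0 \<le> J \<Longrightarrow> J \<le> j \<Longrightarrow> j \<le> J\<^sup>2 \<Longrightarrow> s \<in> {0..1} \<Longrightarrow> \<bar>s - t\<bar> \<le> 2 / 2 ^ J \<Longrightarrow>
      c j s \<le> 2 powr (- (\<alpha> * j))"
  shows "\<exists>C>0. \<exists>R>0. \<forall>x\<in>{0..1}. \<bar>x - t\<bar> < R \<longrightarrow> \<bar>series x - series t\<bar> \<le> C * \<bar>x - t\<bar> powr \<alpha>"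
proof -
  \<comment> \<open>As \<open>\<alpha> < 1\<close>, the head is geometric with ratio
    \<open>2 * b > 1\<close>, so its last term dominates; as \<open>\<alpha> > 0\<close>, the tail
    ratio \<open>b\<close> is below 1.\<close>
  define b :: real where "b = 2 powr (- \<alpha>)"
  have b: "1/2 < b" "b < 1"
    using powr_less_mono[of "-1" "-\<alpha>" 2] powr_less_mono[of "-\<alpha>" 0 2] \<alpha> by (auto simp: b_def powr_minus_divide)
  have bpow: "2 powr (- (\<alpha> * j)) = b ^ j" for j
    by (simp add: b_def powr_powr mult.commute flip: powr_realpow)
  define Z where "Z = (\<Sum>j. 1 / (real j + 1)\<^sup>2)"
  have Z: "Z \<ge> 0" unfolding Z_def by (intro suminf_nonneg summable_inverse_square) auto
  \<comment> \<open>The summands belong to the head, to the geometric part of the tail, and to the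
    capped part.\<close>
  define C where "C = 2 ^ J0 * 2 / (2 * b - 1) + 1 / (1 - b) + 2 * Z"
  have "2 ^ J0 * 2 / (2 * b - 1) > 0" "1 / (1 - b) > 0" using b by simp_all
  then have "C > 0" unfolding C_def using Z by linarith
  show ?thesis
  proof (rule exI[of _ C], rule conjI[rotated], rule exI[of _ "1 / 2 ^ J0"], intro conjI ballI impI)
    fix x assume x: "x \<in> {0..1}" "\<bar>x - t\<bar> < 1 / 2 ^ J0"
    show "\<bar>series x - series t\<bar> \<le> C * \<bar>x - t\<bar> powr \<alpha>"
    proof (cases "x = t")
      case False
      define D where "D = \<bar>x - t\<bar>"
      have D: "0 < D" "D \<le> 1 / 2 ^ J0" using x False by (auto simp: D_def)
      obtain J where J: "J0 \<le> J" "1 / 2 ^ Suc J < D" "D \<le> 1 / 2 ^ J" using dyadic_scale[OF D] by blast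
      have D1: "D \<le> 1" using J(3) by (rule order_trans) (simp add: divide_le_eq_1)
      have bJ: "b ^ Suc J \<le> D powr \<alpha>"
      proof -
        have "b ^ Suc J = (1 / 2 ^ Suc J) powr \<alpha>"
          by (simp add: powr_divide powr_minus_divide powr_powr mult.commute flip: powr_realpow bpow del: power_Suc)
        also have "\<dots> \<le> D powr \<alpha>" using J \<alpha> by (intro powr_mono2) auto
        finally show ?thesis .
      qed
      have DJ: "1 / 2 ^ J \<le> 2 * D powr \<alpha>"
      proof -
        have "1 / 2 ^ J \<le> 2 * D" using J(2) by (simp add: field_simps)
        also have "D \<le> D powr \<alpha>" using powr_mono'[of \<alpha> 1 D] \<alpha> D D1 by simp
        finally show ?thesis by simp
      qed
      define d where "d j = layer c j x - layer c j t" for j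
      have sd: "summable d" unfolding d_def by (intro summable_diff summable_layer)
      have near: "\<bar>node j x - t\<bar> \<le> 1 / 2 ^ j + D" "\<bar>node j t - t\<bar> \<le> 1 / 2 ^ j + D" for j
        using abs_node_diff_le[of j x] abs_node_diff_le[of j t] D by (auto simp: D_def)
      have head: "\<bar>d j\<bar> \<le> 2 ^ J0 * (2 * b) ^ j * D" if "j \<le> J" for j
      proof -
        \<comment> \<open>The factor \<open>2 ^ J0\<close> covers the generations below
          \<open>J0\<close>, for which no decay is assumed.\<close>
        have M: "c j s \<le> 2 ^ J0 * b ^ j" if s: "s \<in> {0..1}" "\<bar>s - t\<bar> \<le> 1 / 2 ^ j + D" for s
        proof (cases "J0 \<le> j")
          case True
          have "D \<le> 1 / 2 ^ j"
            using J(3) by (rule order_trans) (use \<open>j \<le> J\<close> in \<open>auto intro!: divide_left_mono power_increasing\<close>)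
          then have "\<bar>s - t\<bar> \<le> 2 / 2 ^ j" using s(2) by simp
          moreover have "j \<le> j\<^sup>2" by (cases j) (auto simp: power2_eq_square)
          \<comment> \<open>\<open>decay\<close> is applied with both generations equal to
            \<open>j\<close>.\<close>
          ultimately have "c j s \<le> b ^ j" using decay[OF True, of j s] s(1) bpow by auto
          also have "\<dots> \<le> 2 ^ J0 * b ^ j" using b by (simp add: mult_le_cancel_right1)
          finally show ?thesis .
        next
          case False
          have "c j s \<le> 1" by (rule coeff_le_one)
          also have "1 \<le> (2 * b) ^ j" using b by (intro one_le_power) auto
          also have "\<dots> = 2 ^ j * b ^ j" by (simp add: power_mult_distrib)
          also have "\<dots> \<le> 2 ^ J0 * b ^ j" using b False by (intro mult_right_mono power_increasing) auto
          finally show ?thesis .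
        qed
        have "\<bar>d j\<bar> \<le> (2 ^ J0 * b ^ j) * (2 ^ j * \<bar>x - t\<bar>)"
          unfolding d_def using x(1) t near by (intro layer_diff_le coeff_nonneg M node_mem)
        then show ?thesis by (simp add: D_def power_mult_distrib mult_ac)
      qed
      \<comment> \<open>The bounds for generations up to and beyond \<open>J\<^sup>2\<close> are
        added, giving one summable majorant for the whole tail.\<close>
      have tail: "\<bar>d (i + Suc J)\<bar> \<le> b ^ Suc J * b ^ i + (1 / 2 ^ J) * (1 / (real i + 1)\<^sup>2)" for i
      proof -
        define j where "j = i + Suc J"
        have M: "c j s \<le> b ^ j + (1 / 2 ^ J) * (1 / (real i + 1)\<^sup>2)"
          if s: "s \<in> {0..1}" "\<bar>s - t\<bar> \<le> 1 / 2 ^ j + D" for s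
        proof (cases "j \<le> J\<^sup>2")
          case True
          have "1 / 2 ^ j \<le> (1::real) / 2 ^ J"
            by (intro divide_left_mono power_increasing) (auto simp: j_def)
          then have "\<bar>s - t\<bar> \<le> 2 / 2 ^ J" using s(2) J(3) by simp
          moreover have "J \<le> j" by (simp add: j_def)
          ultimately have "c j s \<le> b ^ j" using decay[OF J(1) _ True s(1)] unfolding bpow by blast
          then show ?thesis by (rule order_trans) simp
        next
          case False
          then have "(real J)\<^sup>2 \<le> real j" by (metis nat_le_linear of_nat_le_iff of_nat_power)
          then have "real J \<le> sqrt j" by (rule real_le_rsqrt)
          then have "2 powr (- sqrt j) \<le> 2 powr (- real J)" by (intro powr_mono) auto
          also have "\<dots> = 1 / 2 ^ J" by (simp add: powr_minus_divide powr_realpow)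
          finally have "2 powr (- sqrt j) / (real j + 1)\<^sup>2 \<le> (1 / 2 ^ J) / (real i + 1)\<^sup>2"
            by (intro frac_le power_mono) (auto simp: j_def)
          moreover have "0 \<le> b ^ j" using b by simp
          ultimately show ?thesis using coeff_le[of j s] by simp
        qed
        \<comment> \<open>Both values are nonnegative, so a common bound for the coefficients
          already bounds their difference.\<close>
        have "0 \<le> layer c j x" "layer c j x \<le> c j (node j x)" "0 \<le> layer c j t" "layer c j t \<le> c j (node j t)"
          by (rule layer_nonneg layer_le_coeff)+
        moreover have "c j (node j x) \<le> b ^ j + (1 / 2 ^ J) * (1 / (real i + 1)\<^sup>2)"
          "c j (node j t) \<le> b ^ j + (1 / 2 ^ J) * (1 / (real i + 1)\<^sup>2)"
          using M[OF node_mem[OF x(1)] near(1)] M[OF node_mem[OF t] near(2)] by auto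
        ultimately have "\<bar>d j\<bar> \<le> b ^ j + (1 / 2 ^ J) * (1 / (real i + 1)\<^sup>2)"
          unfolding d_def by linarith
        then show ?thesis by (simp add: j_def power_add mult_ac)
      qed
      have S1: "\<bar>\<Sum>j<Suc J. d j\<bar> \<le> 2 ^ J0 * 2 / (2 * b - 1) * D powr \<alpha>"
      proof -
        have "\<bar>\<Sum>j<Suc J. d j\<bar> \<le> (\<Sum>j<Suc J. \<bar>d j\<bar>)" by (rule sum_abs)
        also have "\<dots> \<le> (\<Sum>j<Suc J. 2 ^ J0 * (2 * b) ^ j * D)"
          by (intro sum_mono head) auto
        also have "\<dots> = 2 ^ J0 * D * (\<Sum>j<Suc J. (2 * b) ^ j)"
          by (simp only: sum_distrib_left mult_ac)
        also have "(\<Sum>j<Suc J. (2 * b) ^ j) = ((2 * b) ^ Suc J - 1) / (2 * b - 1)"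
          using b by (intro geometric_sum) auto
        also have "2 ^ J0 * D * (((2 * b) ^ Suc J - 1) / (2 * b - 1)) \<le> 2 ^ J0 * D * ((2 * b) ^ Suc J / (2 * b - 1))"
          using b D by (intro mult_left_mono divide_right_mono) auto
        also have "\<dots> = 2 ^ J0 / (2 * b - 1) * (D * 2 ^ Suc J) * b ^ Suc J"
          by (simp add: power_mult_distrib)
        also have "\<dots> \<le> 2 ^ J0 / (2 * b - 1) * 2 * D powr \<alpha>"
          using b D bJ J(3) by (intro mult_mono mult_left_mono) (auto simp: field_simps)
        finally show ?thesis by simp
      qed
      have S2: "\<bar>\<Sum>i. d (i + Suc J)\<bar> \<le> (1 / (1 - b) + 2 * Z) * D powr \<alpha>"
      proof -
        have sb: "summable (\<lambda>i. b ^ Suc J * b ^ i + (1 / 2 ^ J) * (1 / (real i + 1)\<^sup>2))"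
          using b by (intro summable_add summable_mult summable_inverse_square summable_geometric) auto
        have "\<bar>\<Sum>i. d (i + Suc J)\<bar> \<le> (\<Sum>i. b ^ Suc J * b ^ i + (1 / 2 ^ J) * (1 / (real i + 1)\<^sup>2))"
          using norm_suminf_le[OF _ sb, of "\<lambda>i. d (i + Suc J)"] tail by simp
        also have "\<dots> = b ^ Suc J * (1 / (1 - b)) + (1 / 2 ^ J) * Z"
        proof -
          have "(\<lambda>i. b ^ Suc J * b ^ i + (1 / 2 ^ J) * (1 / (real i + 1)\<^sup>2)) sums
              (b ^ Suc J * (1 / (1 - b)) + (1 / 2 ^ J) * Z)"
            unfolding Z_def using b
            by (intro sums_add sums_mult summable_sums summable_inverse_square geometric_sums) auto
          then show ?thesis by (rule sums_unique[symmetric])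
        qed
        also have "\<dots> \<le> D powr \<alpha> * (1 / (1 - b)) + (2 * D powr \<alpha>) * Z"
          using bJ DJ b Z by (intro add_mono mult_right_mono) auto
        finally show ?thesis by (simp add: algebra_simps)
      qed
      have "series x - series t = suminf d"
        unfolding series_def d_def by (rule suminf_diff) (rule summable_layer)+
      also have "\<dots> = (\<Sum>i. d (i + Suc J)) + (\<Sum>j<Suc J. d j)"
        by (rule suminf_split_initial_segment[OF sd])
      finally have "\<bar>series x - series t\<bar> \<le> \<bar>\<Sum>i. d (i + Suc J)\<bar> + \<bar>\<Sum>j<Suc J. d j\<bar>"
        by linarith
      also have "\<dots> \<le> C * D powr \<alpha>" using S1 S2 by (simp add: C_def distrib_right)
      finally show ?thesis by (simp add: D_def)
    qed simp
  qed (use \<open>C > 0\<close> in auto)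
qed

end

section \<open>Prescribing the exponent\<close>

text \<open>\<open>N n\<close> is a generation at whose scale \<open>Hs n\<close> varies by less
  than \<open>1 / (real n + 1)\<close>. Choosing \<open>m j\<close> with
  \<open>(N (m j))\<^sup>2 \<le> j\<close> gives \<open>N (m j) \<le> J\<close> whenever
  \<open>j \<le> J\<^sup>2\<close>, so \<open>Hs (m j)\<close> hardly varies over the distance in
  question. Still \<open>m\<close> tends to infinity, and pointwise convergence at \<open>t\<close>
  does the rest.\<close>

lemma slow_reparametrization:
  fixes H :: "real \<Rightarrow> real" and Hs :: "nat \<Rightarrow> real \<Rightarrow> real"
  assumes cont: "\<And>n. continuous_on {0..1} (Hs n)" and lim: "\<And>t. t \<in> {0..1} \<Longrightarrow> (\<lambda>n. Hs n t) \<longlonglongrightarrow> H t"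
  obtains m :: "nat \<Rightarrow> nat" where
    "\<And>t \<epsilon>. t \<in> {0..1} \<Longrightarrow> \<epsilon> > 0 \<Longrightarrow> \<exists>J0. \<forall>J j s. J0 \<le> J \<longrightarrow> J \<le> j \<longrightarrow> j \<le> J\<^sup>2 \<longrightarrow> s \<in> {0..1} \<longrightarrow>
       \<bar>s - t\<bar> \<le> 2 / 2 ^ J \<longrightarrow> \<bar>Hs (m j) s - H t\<bar> < \<epsilon>"
proof -
  have "\<exists>N. \<forall>x\<in>{0..1}. \<forall>y\<in>{0..1}. \<bar>x - y\<bar> \<le> 2 / 2 ^ N \<longrightarrow> \<bar>Hs n x - Hs n y\<bar> < 1 / (real n + 1)" for n
  proof -
    have "uniformly_continuous_on {0..1} (Hs n)" using cont by (intro compact_uniformly_continuous) auto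
    moreover have "1 / (real n + 1) > 0" by simp
    ultimately obtain \<delta> where \<delta>: "\<delta> > 0"
      "\<forall>x\<in>{0..1}. \<forall>y\<in>{0..1}. dist y x < \<delta> \<longrightarrow> dist (Hs n y) (Hs n x) < 1 / (real n + 1)"
      unfolding uniformly_continuous_on_def by blast
    obtain N where N: "(1/2) ^ N < \<delta> / 2" using real_arch_pow_inv[of "\<delta> / 2" "1/2"] \<delta>(1) by auto
    then have "2 / 2 ^ N < \<delta>" by (simp add: power_one_over)
    then show ?thesis using \<delta>(2) by (intro exI[of _ N]) (auto simp: dist_real_def)
  qed
  then obtain N where N: "\<And>n x y. x \<in> {0..1} \<Longrightarrow> y \<in> {0..1} \<Longrightarrow> \<bar>x - y\<bar> \<le> 2 / 2 ^ N n \<Longrightarrow>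
      \<bar>Hs n x - Hs n y\<bar> < 1 / (real n + 1)"
    by metis
  \<comment> \<open>The alternative \<open>n = 0\<close> keeps the set nonempty, and
    \<open>n \<le> j\<close> keeps it finite.\<close>
  define m where "m j = Max {n. n = 0 \<or> (n \<le> j \<and> (N n)\<^sup>2 \<le> j)}" for j
  have fin: "finite {n. n = 0 \<or> (n \<le> j \<and> (N n)\<^sup>2 \<le> j)}" for j
    by (rule finite_subset[of _ "{..j}"]) auto
  have m_ge: "n \<le> m j" if "n \<le> j" "(N n)\<^sup>2 \<le> j" for n j
    unfolding m_def using fin that by (intro Max_ge) auto
  have m_N: "(N (m j))\<^sup>2 \<le> j" if "(N 0)\<^sup>2 \<le> j" for j
  proof -
    have "m j \<in> {n. n = 0 \<or> (n \<le> j \<and> (N n)\<^sup>2 \<le> j)}"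
      unfolding m_def using fin by (intro Max_in) auto
    then show ?thesis using that by auto
  qed
  show ?thesis
  proof (rule that[of m])
    fix t \<epsilon> :: real assume t: "t \<in> {0..1}" and \<epsilon>: "\<epsilon> > 0"
    obtain n0 where n0: "\<And>n. n0 \<le> n \<Longrightarrow> \<bar>Hs n t - H t\<bar> < \<epsilon> / 2"
      using LIMSEQ_D[OF lim[OF t], of "\<epsilon> / 2"] \<epsilon> by auto
    obtain n1 where n1: "2 / \<epsilon> < real n1" using reals_Archimedean2 by blast
    \<comment> \<open>\<open>n0\<close> controls the convergence at \<open>t\<close>,
      \<open>n1\<close> the variation \<open>1 / (real n + 1)\<close>.\<close>
    define n where "n = max n0 n1"
    show "\<exists>J0. \<forall>J j s. J0 \<le> J \<longrightarrow> J \<le> j \<longrightarrow> j \<le> J\<^sup>2 \<longrightarrow> s \<in> {0..1} \<longrightarrow>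
       \<bar>s - t\<bar> \<le> 2 / 2 ^ J \<longrightarrow> \<bar>Hs (m j) s - H t\<bar> < \<epsilon>"
    \<comment> \<open>The first two summands force \<open>n \<le> m j\<close>; the last ensures
      \<open>(N (m j))\<^sup>2 \<le> j\<close> even where \<open>m j\<close> takes its default value
      0.\<close>
    proof (intro exI[of _ "n + (N n)\<^sup>2 + (N 0)\<^sup>2"] allI impI)
      fix J j s assume J: "n + (N n)\<^sup>2 + (N 0)\<^sup>2 \<le> J" "J \<le> j" "j \<le> J\<^sup>2" and s: "s \<in> {0..1}" "\<bar>s - t\<bar> \<le> 2 / 2 ^ J"
      have "n \<le> m j" using J by (intro m_ge) auto
      have "(N 0)\<^sup>2 \<le> j" using J by linarith
      then have "(N (m j))\<^sup>2 \<le> J\<^sup>2" using J(3) by (rule le_trans[OF m_N])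
      then have "N (m j) \<le> J" by (simp only: power2_nat_le_eq_le)
      then have "2 / 2 ^ J \<le> (2::real) / 2 ^ N (m j)" by (intro divide_left_mono power_increasing) auto
      then have "\<bar>Hs (m j) s - Hs (m j) t\<bar> < 1 / (real (m j) + 1)" using s t by (intro N) auto
      also have "\<dots> \<le> \<epsilon> / 2"
      proof -
        have "2 / \<epsilon> \<le> real (m j) + 1" using n1 \<open>n \<le> m j\<close> by (simp add: n_def)
        then show ?thesis using \<epsilon> by (simp add: field_simps)
      qed
      finally have "\<bar>Hs (m j) s - Hs (m j) t\<bar> < \<epsilon> / 2" .
      moreover have "\<bar>Hs (m j) t - H t\<bar> < \<epsilon> / 2" using n0[of "m j"] \<open>n \<le> m j\<close> by (simp add: n_def)
      ultimately show "\<bar>Hs (m j) s - H t\<bar> < \<epsilon>" by linarith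
    qed
  qed
qed

lemma prescribed_exponent:
  fixes H :: "real \<Rightarrow> real" and Hs :: "nat \<Rightarrow> real \<Rightarrow> real"
  assumes H: "H \<in> {0..1} \<rightarrow> {0..1}" and cont: "\<And>n. continuous_on {0..1} (Hs n)"
    and lim: "\<And>t. t \<in> {0..1} \<Longrightarrow> (\<lambda>n. Hs n t) \<longlonglongrightarrow> H t"
  obtains f :: "real \<Rightarrow> real" where "continuous_on {0..1} f"
    "\<And>t. t \<in> {0..1} \<Longrightarrow> lower_holder_exp {0..1} f t = ereal (H t)"
    "\<And>t. t \<in> {0..1} \<Longrightarrow> upper_holder_exp {0..1} f t = ereal (H t)"
proof -
  obtain m where m: "\<And>t \<epsilon>. t \<in> {0..1} \<Longrightarrow> \<epsilon> > 0 \<Longrightarrow> \<exists>J0. \<forall>J j s. J0 \<le> J \<longrightarrow> J \<le> j \<longrightarrow> j \<le> J\<^sup>2 \<longrightarrow> s \<in> {0..1} \<longrightarrow>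
       \<bar>s - t\<bar> \<le> 2 / 2 ^ J \<longrightarrow> \<bar>Hs (m j) s - H t\<bar> < \<epsilon>"
    using slow_reparametrization[OF cont lim] by blast
  \<comment> \<open>The minimum secures the bound of the locale whatever values \<open>Hs\<close>
    takes.\<close>
  define c where "c j x = min (2 powr (- (Hs (m j) x * j))) (2 powr (- sqrt j) / (real j + 1)\<^sup>2)" for j x
  interpret schauder_series c
    by standard (auto simp: c_def)
  have exps: "lower_holder_exp {0..1} series t = ereal (H t)" "upper_holder_exp {0..1} series t = ereal (H t)"
    if t: "t \<in> {0..1}" for t
  proof -
    have Ht: "0 \<le> H t" "H t \<le> 1" using H t by auto
    note eqI = holder_exponents_eqI[OF continuous_series t Ht]
    have regular: "\<exists>C>0. \<exists>R>0. \<forall>x\<in>{0..1}. \<bar>x - t\<bar> < R \<longrightarrow> \<bar>series x - series t\<bar> \<le> C * \<bar>x - t\<bar> powr \<alpha>"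
      if \<alpha>: "0 < \<alpha>" "\<alpha> < H t" for \<alpha>
    proof -
      obtain J0 where J0: "\<And>J j s. J0 \<le> J \<Longrightarrow> J \<le> j \<Longrightarrow> j \<le> J\<^sup>2 \<Longrightarrow> s \<in> {0..1} \<Longrightarrow>
         \<bar>s - t\<bar> \<le> 2 / 2 ^ J \<Longrightarrow> \<bar>Hs (m j) s - H t\<bar> < H t - \<alpha>"
        using m[OF t, of "H t - \<alpha>"] \<alpha> by auto
      have "c j s \<le> 2 powr (- (\<alpha> * j))"
        if "J0 \<le> J" "J \<le> j" "j \<le> J\<^sup>2" "s \<in> {0..1}" "\<bar>s - t\<bar> \<le> 2 / 2 ^ J" for J j s
      proof -
        have "\<alpha> \<le> Hs (m j) s" using J0[OF that] by linarith
        then have "2 powr (- (Hs (m j) s * j)) \<le> 2 powr (- (\<alpha> * j))"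
          by (intro powr_mono) (auto intro: mult_right_mono)
        then show ?thesis unfolding c_def by (rule min.coboundedI1)
      qed
      then show ?thesis using series_regular[OF t, of \<alpha> J0] \<alpha> Ht by auto
    qed
    have irregular: "\<exists>C>0. \<exists>R>0. \<forall>r. 0 < r \<and> r \<le> R \<longrightarrow> (\<exists>x h. 0 < h \<and> 2 * h < r \<and>
        x \<in> rel_ball {0..1} t r \<and> x + 2 * h \<in> rel_ball {0..1} t r \<and>
        C * r powr \<beta> \<le> \<bar>series (x + 2 * h) - 2 * series (x + h) + series x\<bar>)" if \<beta>: "H t < \<beta>" for \<beta>
    proof -
      have "\<beta> > 0" using \<beta> Ht by simp
      \<comment> \<open>Since \<beta> is positive even where \<open>H t = 0\<close>, the
        subexponential cap is eventually larger than the required lower bound and does not spoil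
        irregularity.\<close>
      then have "\<forall>\<^sub>F j::nat in sequentially. 2 powr (- (\<beta> * j)) \<le> 2 powr (- sqrt j) / (real j + 1)\<^sup>2"
        by real_asymp
      then obtain J1 where J1: "\<And>j. J1 \<le> j \<Longrightarrow> 2 powr (- (\<beta> * real j)) \<le> 2 powr (- sqrt j) / (real j + 1)\<^sup>2"
        by (auto simp: eventually_sequentially)
      obtain J0 where J0: "\<And>J j s. J0 \<le> J \<Longrightarrow> J \<le> j \<Longrightarrow> j \<le> J\<^sup>2 \<Longrightarrow> s \<in> {0..1} \<Longrightarrow>
         \<bar>s - t\<bar> \<le> 2 / 2 ^ J \<Longrightarrow> \<bar>Hs (m j) s - H t\<bar> < \<beta> - H t"
        using m[OF t, of "\<beta> - H t"] \<beta> by auto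
      have "2 powr (- (\<beta> * J)) \<le> c J s"
        if "max J0 J1 \<le> J" "s \<in> {0..1}" "\<bar>s - t\<bar> \<le> 1 / 2 ^ J" for J s
      proof -
        have "\<bar>s - t\<bar> \<le> 2 / 2 ^ J" using that(3) by (rule order_trans) (simp add: divide_right_mono)
        moreover have "J \<le> J\<^sup>2" by (cases J) (auto simp: power2_eq_square)
        ultimately have "Hs (m J) s \<le> \<beta>" using J0[of J J s] that by auto
        then have "2 powr (- (\<beta> * J)) \<le> 2 powr (- (Hs (m J) s * J))"
          by (intro powr_mono) (auto intro: mult_right_mono)
        then show ?thesis using J1[of J] that by (simp add: c_def)
      qed
      then show ?thesis using series_irregular[OF t \<open>\<beta> > 0\<close>, of "max J0 J1"] by blast
    qed
    show "lower_holder_exp {0..1} series t = ereal (H t)" "upper_holder_exp {0..1} series t = ereal (H t)"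
      using eqI[OF regular irregular] by auto
  qed
  show ?thesis using that[OF continuous_series exps] .
qed

theorem theorem3:
  shows "(\<forall>f :: real \<Rightarrow> real.
            continuous_on {0..1} f \<and>
            (\<forall>t\<in>{0..1}. \<not> f differentiable (at t within {0..1})) \<and>
            (\<forall>t\<in>{0..1}. lower_holder_exp {0..1} f t = upper_holder_exp {0..1} f t) \<longrightarrow>
            (\<exists>H :: nat \<Rightarrow> real \<Rightarrow> real.
               (\<forall>j. continuous_on {0..1} (H j) \<and> H j \<in> {0..1} \<rightarrow> {0..1}) \<and>
               (\<forall>t\<in>{0..1}. lower_holder_exp {0..1} f t = upper_holder_exp {0..1} f t \<and>
                  (\<exists>l. (\<lambda>j. H j t) \<longlonglongrightarrow> l \<and> upper_holder_exp {0..1} f t = ereal l))))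
       \<and> (\<forall>(H :: real \<Rightarrow> real) (Hs :: nat \<Rightarrow> real \<Rightarrow> real).
            H \<in> {0..1} \<rightarrow> {0..1} \<and>
            (\<forall>j. continuous_on {0..1} (Hs j)) \<and>
            (\<forall>t\<in>{0..1}. (\<lambda>j. Hs j t) \<longlonglongrightarrow> H t) \<longrightarrow>
            (\<exists>f :: real \<Rightarrow> real. continuous_on {0..1} f \<and>
               (\<forall>t\<in>{0..1}. lower_holder_exp {0..1} f t = upper_holder_exp {0..1} f t \<and>
                  upper_holder_exp {0..1} f t = ereal (H t))))"
proof (intro conjI allI impI; (elim conjE)?)
  fix f :: "real \<Rightarrow> real"
  assume f: "continuous_on {0..1} f" "\<forall>t\<in>{0..1}. \<not> f differentiable (at t within {0..1})"
    and eq: "\<forall>t\<in>{0..1}. lower_holder_exp {0..1} f t = upper_holder_exp {0..1} f t"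
  then obtain H :: "nat \<Rightarrow> real \<Rightarrow> real" where
    "\<And>j. continuous_on {0..1} (H j)" "\<And>j. H j \<in> {0..1} \<rightarrow> {0..1}"
    "\<And>t. t \<in> {0..1} \<Longrightarrow> \<exists>l. (\<lambda>j. H j t) \<longlonglongrightarrow> l \<and> upper_holder_exp {0..1} f t = ereal l"
    using exponent_baire_one[of f] by blast
  then show "\<exists>H :: nat \<Rightarrow> real \<Rightarrow> real.
      (\<forall>j. continuous_on {0..1} (H j) \<and> H j \<in> {0..1} \<rightarrow> {0..1}) \<and>
      (\<forall>t\<in>{0..1}. lower_holder_exp {0..1} f t = upper_holder_exp {0..1} f t \<and>
         (\<exists>l. (\<lambda>j. H j t) \<longlonglongrightarrow> l \<and> upper_holder_exp {0..1} f t = ereal l))"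
    using eq by blast
next
  fix H :: "real \<Rightarrow> real" and Hs :: "nat \<Rightarrow> real \<Rightarrow> real"
  assume "H \<in> {0..1} \<rightarrow> {0..1}" "\<forall>j. continuous_on {0..1} (Hs j)"
    "\<forall>t\<in>{0..1}. (\<lambda>j. Hs j t) \<longlonglongrightarrow> H t"
  then obtain f :: "real \<Rightarrow> real" where "continuous_on {0..1} f"
    "\<And>t. t \<in> {0..1} \<Longrightarrow> lower_holder_exp {0..1} f t = ereal (H t)"
    "\<And>t. t \<in> {0..1} \<Longrightarrow> upper_holder_exp {0..1} f t = ereal (H t)"
    using prescribed_exponent[of H Hs] by blast
  then show "\<exists>f :: real \<Rightarrow> real. continuous_on {0..1} f \<and>
      (\<forall>t\<in>{0..1}. lower_holder_exp {0..1} f t = upper_holder_exp {0..1} f t \<and>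
         upper_holder_exp {0..1} f t = ereal (H t))"
    by auto
qed

end
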